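(* There is an absolute constant $C>0$, and for every integer $q\geq 4$ a constant $c_q>0$ depending only on $q$, such that for every positive integer $N$, every $N$-vertex tournament $T$, and every coloring of the edges of $T$ with $q$ colors, $T$ contains a color-avoiding directed path with at least $c_q N^{1-C/\sqrt{\log q}}$ vertices.
   Context: Logarithms are to base $2$. A tournament is an orientation of a complete graph (exactly one directed edge between each pair of distinct vertices). A directed path is a sequence of distinct vertices $v_1,\dots,v_L$ with $v_j\to v_{j+1}$ for all $j<L$; its length is its number of vertices. With colors from $[q]$, a path is color-avoiding if some color of $[q]$ appears on none of its edges. *)

theory Defs
  imports Complex_Main
begin

definition tournament :: "nat \<Rightarrow> (nat \<Rightarrow> nat \<Rightarrow> bool) \<Rightarrow> bool" where
  "tournament N T \<longleftrightarrow>
     (\<forall>u v. T u v \<longrightarrow> u < N \<and> v < N) \<and>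
     (\<forall>u<N. \<not> T u u) \<and>
     (\<forall>u<N. \<forall>v<N. u \<noteq> v \<longrightarrow> (T u v \<longleftrightarrow> \<not> T v u))"

definition edge_coloring :: "nat \<Rightarrow> (nat \<Rightarrow> nat \<Rightarrow> bool) \<Rightarrow> nat \<Rightarrow> (nat \<Rightarrow> nat \<Rightarrow> nat) \<Rightarrow> bool" where
  "edge_coloring N T q col \<longleftrightarrow> (\<forall>u<N. \<forall>v<N. T u v \<longrightarrow> col u v \<in> {1..q})"

(* Directed path: sequence of distinct vertices with consecutive edges; length = number of vertices. *)
definition directed_path :: "nat \<Rightarrow> (nat \<Rightarrow> nat \<Rightarrow> bool) \<Rightarrow> nat list \<Rightarrow> bool" where
  "directed_path N T p \<longleftrightarrow> distinct p \<and> set p \<subseteq> {0..<N} \<and>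
     (\<forall>j. Suc j < length p \<longrightarrow> T (p ! j) (p ! Suc j))"

definition color_avoiding :: "nat \<Rightarrow> (nat \<Rightarrow> nat \<Rightarrow> nat) \<Rightarrow> nat list \<Rightarrow> bool" where
  "color_avoiding q col p \<longleftrightarrow>
     (\<exists>c\<in>{1..q}. \<forall>j. Suc j < length p \<longrightarrow> col (p ! j) (p ! Suc j) \<noteq> c)"

end

theory Submission
  imports Defs
begin

text \<open>
  The exponent comes from a potential argument. For a digraph \<open>E\<close> and a vertex set \<open>V\<close>, spread a probability
  distribution over vertex-disjoint \<open>E\<close>-paths (items) in \<open>V\<close>, in a fixed linear order, whose first and last thirds hit
  every vertex with probability \<open>O(1/|V|)\<close>. Two items are linked if an edge leads from the last third of the
  first to the first third of the second. Placing each item on the integer line at the length of the longest chain leading to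
  it, a point of the line is covered by items of bounded total weight (a Kraft inequality), and the expected
  logarithm of length times weight over probability bounds the logarithm of the longest path from below.

  A vertex set of size \<open>n\<close> is treated in one of two ways. Either almost every colour \<open>i\<close> has disjoint paths avoiding \<open>i\<close>, each
  with a constant fraction of the vertices, that cover half of the set; these are the items. Or, for some sparse colour, half of the set contains no such
  path, and the finishing order of a depth-first search cuts it into \<open>m\<close> pieces such that all backward
  edges have this sparse colour. Forward edges of a random colour are then so rare that consecutive pieces
  are almost always linked, and medians of the positions separate the pieces on the line up to neighbours: the
  potential grows by \<open>log m - O(1)\<close>, averaged over the colours. With \<open>m\<close> a fixed power of \<open>q\<close> the loss per factor \<open>m\<close> is constant,
  which even gives the exponent \<open>1 - O(1 / log q)\<close>.
\<close>

section \<open>Spreading path systems\<close>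

definition dpath :: "('a \<Rightarrow> 'a \<Rightarrow> bool) \<Rightarrow> 'a list \<Rightarrow> bool" where
  "dpath E xs \<longleftrightarrow> distinct xs \<and> successively E xs"

text \<open>Rounding up makes the first and the last part of a nonempty path nonempty; on a path the
  two parts still share at most one vertex.\<close>

definition third :: "'a list \<Rightarrow> nat" where
  "third xs = (length xs + 2) div 3"

definition hd_part :: "'a list \<Rightarrow> 'a set" where
  "hd_part xs = set (take (third xs) xs)"

definition tl_part :: "'a list \<Rightarrow> 'a set" where
  "tl_part xs = set (drop (length xs - third xs) xs)"

text \<open>However a path is entered in its first third and left in its last third, at least this many vertices are traversed.\<close>

definition wt :: "'a list \<Rightarrow> nat" where
  "wt xs = length xs + 2 - 2 * third xs"

definition linked :: "('a \<Rightarrow> 'a \<Rightarrow> bool) \<Rightarrow> 'a list \<Rightarrow> 'a list \<Rightarrow> bool" where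
  "linked E x y \<longleftrightarrow> (\<exists>u\<in>tl_part x. \<exists>v\<in>hd_part y. E u v)"

text \<open>Only pairs in list order are constrained, so an admissible \<open>s\<close> stays
  admissible on sublists. This is why \<open>spreads\<close> ranges over all admissible
  \<open>s\<close> and not just over longest-chain positions: once pieces are combined, the
  positions inside one piece also depend on the others.\<close>

definition admissible :: "('a \<Rightarrow> 'a \<Rightarrow> bool) \<Rightarrow> ('a list \<Rightarrow> nat) \<Rightarrow> 'a list list \<Rightarrow> bool" where
  "admissible E s Q \<longleftrightarrow> sorted_wrt (\<lambda>x y. linked E x y \<longrightarrow> s x + wt x \<le> s y) Q"

definition active :: "('a list \<Rightarrow> nat) \<Rightarrow> nat \<Rightarrow> 'a list list \<Rightarrow> 'a list set" where
  "active s t Q = {x \<in> set Q. s x \<le> t \<and> t < s x + wt x}"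

definition disjoint_paths :: "('a \<Rightarrow> 'a \<Rightarrow> bool) \<Rightarrow> 'a set \<Rightarrow> 'a list list \<Rightarrow> bool" where
  "disjoint_paths E V Q \<longleftrightarrow> (\<forall>x\<in>set Q. x \<noteq> [] \<and> dpath E x \<and> set x \<subseteq> V) \<and>
     sorted_wrt (\<lambda>x y. set x \<inter> set y = {}) Q"

text \<open>The last two conditions bound hitting probabilities: draw an item according to
  \<open>p\<close>, then a uniform vertex of its last (or first) third.\<close>

definition path_system :: "('a \<Rightarrow> 'a \<Rightarrow> bool) \<Rightarrow> 'a set \<Rightarrow> 'a list list \<Rightarrow> ('a list \<Rightarrow> real) \<Rightarrow> bool" where
  "path_system E V Q p \<longleftrightarrow> disjoint_paths E V Q \<and>
     (\<forall>x\<in>set Q. p x > 0) \<and> (\<Sum>x\<in>set Q. p x) = 1 \<and>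
     (\<forall>u\<in>V. (\<Sum>x\<in>set Q. p x / real (third x) * of_bool (u \<in> tl_part x)) \<le> 6 / real (card V)) \<and>
     (\<forall>u\<in>V. (\<Sum>x\<in>set Q. p x / real (third x) * of_bool (u \<in> hd_part x)) \<le> 6 / real (card V))"

text \<open>The function \<open>s\<close> gives the position of each item on the line, and \<open>a\<close> are the Kraft weights.\<close>

definition spreads :: "('a \<Rightarrow> 'a \<Rightarrow> bool) \<Rightarrow> 'a list list \<Rightarrow> ('a list \<Rightarrow> real) \<Rightarrow> real \<Rightarrow> bool" where
  "spreads E Q p \<psi> \<longleftrightarrow> (\<forall>s. admissible E s Q \<longrightarrow> (\<exists>a. (\<forall>x\<in>set Q. a x > 0) \<and>
     (\<forall>t. (\<Sum>x\<in>active s t Q. a x) \<le> 1) \<and>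
     \<psi> \<le> (\<Sum>x\<in>set Q. p x * ln (real (wt x) * a x / p x))))"

definition spread :: "('a \<Rightarrow> 'a \<Rightarrow> bool) \<Rightarrow> 'a set \<Rightarrow> real \<Rightarrow> bool" where
  "spread E V \<psi> \<longleftrightarrow> (\<exists>Q p. path_system E V Q p \<and> spreads E Q p \<psi>)"

lemma third_pos: "x \<noteq> [] \<Longrightarrow> 0 < third x"
  by (cases x) (auto simp: third_def)

lemma third_le: "x \<noteq> [] \<Longrightarrow> third x \<le> length x"
  by (cases x) (auto simp: third_def)

lemma wt_bounds: "x \<noteq> [] \<Longrightarrow> 0 < wt x \<and> length x \<le> 3 * wt x"
  by (cases x) (auto simp: wt_def third_def)

lemma hd_part_subset: "hd_part x \<subseteq> set x" and tl_part_subset: "tl_part x \<subseteq> set x"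
  by (auto simp: hd_part_def tl_part_def dest: in_set_takeD in_set_dropD)

lemma card_parts:
  assumes "x \<noteq> []" "distinct x"
  shows "card (hd_part x) = third x" "card (tl_part x) = third x"
  using assms third_le[OF assms(1)]
  by (simp_all add: hd_part_def tl_part_def distinct_card)

lemma parts_nonempty:
  assumes "x \<noteq> []" shows "hd_part x \<noteq> {}" "tl_part x \<noteq> {}"
  using third_pos[OF assms] third_le[OF assms] assms by (auto simp: hd_part_def tl_part_def)

lemma dpath_take: "dpath E xs \<Longrightarrow> dpath E (take n xs)"
  unfolding dpath_def
  by (metis append_take_drop_id distinct_take successively_append_iff)

lemma dpath_drop: "dpath E xs \<Longrightarrow> dpath E (drop n xs)"
  unfolding dpath_def
  by (metis append_take_drop_id distinct_drop successively_append_iff)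

text \<open>Since \<open>2 * third x \<le> length x + 1\<close>, an index in the first third never
  exceeds an index in the last third, so the part of \<open>x\<close> from \<open>v\<close> to
  \<open>u\<close> runs forward.\<close>

lemma dpath_segment:
  assumes "dpath E x" "v \<in> hd_part x" "u \<in> tl_part x"
  obtains ys where "dpath E ys" "ys \<noteq> []" "hd ys = v" "last ys = u" "set ys \<subseteq> set x" "wt x \<le> length ys"
proof -
  obtain a where a: "a < third x" "a < length x" "x ! a = v"
    using assms(2) by (auto simp: hd_part_def in_set_conv_nth)
  obtain b' where b': "b' < length x - (length x - third x)" "x ! (length x - third x + b') = u"
    using assms(3) by (auto simp: tl_part_def in_set_conv_nth)
  define b where "b = length x - third x + b'"
  have b: "b < length x" "x ! b = u" "length x - third x \<le> b" using b' by (auto simp: b_def)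
  have "a \<le> b" using a b unfolding third_def by linarith
  define ys where "ys = drop a (take (Suc b) x)"
  have len: "length ys = Suc b - a" using b by (simp add: ys_def)
  show ?thesis
  proof
    show "dpath E ys" unfolding ys_def by (intro dpath_drop dpath_take assms)
    show ne: "ys \<noteq> []" using len \<open>a \<le> b\<close> by auto
    show "hd ys = v" using a b \<open>a \<le> b\<close> by (simp add: ys_def hd_drop_conv_nth)
    show "last ys = u" using a b \<open>a \<le> b\<close> ne by (simp add: ys_def last_conv_nth)
    show "set ys \<subseteq> set x" unfolding ys_def by (meson set_drop_subset set_take_subset subset_trans)
    show "wt x \<le> length ys" using a b len \<open>a \<le> b\<close> unfolding wt_def by linarith
  qed
qed

lemma disjoint_paths_append:
  "disjoint_paths E V (Q @ R) \<longleftrightarrow> disjoint_paths E V Q \<and> disjoint_paths E V R \<and>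
     (\<forall>x\<in>set Q. \<forall>y\<in>set R. set x \<inter> set y = {})"
  by (auto simp: disjoint_paths_def sorted_wrt_append)

section \<open>From the potential to a long path\<close>

text \<open>These are the longest-chain positions, built in list order. The end of each item is
  realised by a path that may stop at any vertex of the last third; this freedom lets the induction
  continue along whichever link is used next.\<close>

lemma ex_admissible:
  assumes "disjoint_paths E V Q"
  shows "\<exists>s. admissible E s Q \<and> (\<forall>x\<in>set Q. \<forall>u\<in>tl_part x. \<exists>ys. dpath E ys \<and> ys \<noteq> [] \<and>
     last ys = u \<and> set ys \<subseteq> \<Union>(set ` set Q) \<and> s x + wt x \<le> length ys)"
  using assms
proof (induction Q rule: rev_induct)
  case Nil
  then show ?case by (simp add: admissible_def)
next
  case (snoc x Q)
  have dQ: "disjoint_paths E V Q" and x: "x \<noteq> []" "dpath E x"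
    and dx: "\<forall>y\<in>set Q. set y \<inter> set x = {}"
    using snoc.prems unfolding disjoint_paths_append by (auto simp: disjoint_paths_def)
  from snoc.IH[OF dQ] obtain s where adm: "admissible E s Q"
    and P: "\<And>y u. y \<in> set Q \<Longrightarrow> u \<in> tl_part y \<Longrightarrow> \<exists>ys. dpath E ys \<and> ys \<noteq> [] \<and>
     last ys = u \<and> set ys \<subseteq> \<Union>(set ` set Q) \<and> s y + wt y \<le> length ys" by blast
  have xQ: "x \<notin> set Q" using dx x by fastforce
  define M where "M = (\<lambda>y. s y + wt y) ` {y \<in> set Q. linked E y x}"
  \<comment> \<open>The new item starts at the largest end of an earlier item linked to it, and at 0
    if there is none.\<close>
  define z where "z = (if M = {} then 0 else Max M)"
  have finM: "finite M" by (simp add: M_def)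
  define s' where "s' = s(x := z)"
  have s'Q: "\<And>y. y \<in> set Q \<Longrightarrow> s' y = s y" using xQ by (auto simp: s'_def)
  have "admissible E s' (Q @ [x])"
    unfolding admissible_def sorted_wrt_append
  proof (intro conjI ballI impI)
    show "sorted_wrt (\<lambda>x y. linked E x y \<longrightarrow> s' x + wt x \<le> s' y) Q"
      using adm unfolding admissible_def
      by (rule sorted_wrt_mono_rel[rotated]) (auto simp: s'Q)
  next
    fix y w assume y: "y \<in> set Q" "w \<in> set [x]" "linked E y w"
    then have "s y + wt y \<in> M" by (auto simp: M_def)
    then have "s y + wt y \<le> z" using finM by (auto simp: z_def)
    then show "s' y + wt y \<le> s' w" using y by (simp add: s'Q) (simp add: s'_def)
  qed simp
  moreover have "\<exists>ys. dpath E ys \<and> ys \<noteq> [] \<and> last ys = u \<and> set ys \<subseteq> \<Union>(set ` set (Q @ [x])) \<and> s' y + wt y \<le> length ys"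
    if y: "y \<in> set (Q @ [x])" and u: "u \<in> tl_part y" for y u
  proof (cases "y = x")
    case False
    then have "y \<in> set Q" using y by simp
    from P[OF this u] show ?thesis using s'Q[OF \<open>y \<in> set Q\<close>] by fastforce
  next
    case True
    show ?thesis
    proof (cases "M = {}")
      case M: True
      obtain v where v: "v \<in> hd_part x" using parts_nonempty[OF x(1)] by blast
      obtain ys where "dpath E ys" "ys \<noteq> []" "hd ys = v" "last ys = u" "set ys \<subseteq> set x" "wt x \<le> length ys"
        using dpath_segment[OF x(2) v] u True by blast
      then show ?thesis using True M by (intro exI[of _ ys]) (auto simp: s'_def z_def)
    next
      case M: False
      then have "z \<in> M" using finM by (simp add: z_def)
      then obtain y' where y': "y' \<in> set Q" "linked E y' x" "z = s y' + wt y'" by (auto simp: M_def)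
      then obtain u' v where uv: "u' \<in> tl_part y'" "v \<in> hd_part x" "E u' v" by (auto simp: linked_def)
      obtain ys where ys: "dpath E ys" "ys \<noteq> []" "hd ys = v" "last ys = u" "set ys \<subseteq> set x" "wt x \<le> length ys"
        using dpath_segment[OF x(2) uv(2)] u True by blast
      obtain zs where zs: "dpath E zs" "zs \<noteq> []" "last zs = u'" "set zs \<subseteq> \<Union>(set ` set Q)" "s y' + wt y' \<le> length zs"
        using P[OF y'(1) uv(1)] by blast
      \<comment> \<open>The path to the predecessor uses only earlier items, hence it is disjoint
        from the segment of \<open>x\<close> and the concatenation is simple.\<close>
      have "set zs \<inter> set ys = {}" using dx ys(5) zs(4) by blast
      then have "dpath E (zs @ ys)" using ys zs uv
        by (auto simp: dpath_def successively_append_iff)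
      then show ?thesis using ys zs True y'(3)
        by (intro exI[of _ "zs @ ys"]) (auto simp: s'_def)
    qed
  qed
  ultimately show ?case by blast
qed

text \<open>Place the items at their longest-chain positions and let \<open>L\<close> be the largest
  end, so that some path has at least \<open>L\<close> vertices. Summing the Kraft inequality over
  all points below \<open>L\<close> bounds the total of weight times length by \<open>L\<close>, and
  concavity of \<open>ln\<close> turns this into \<open>\<psi> \<le> ln L\<close>.\<close>

lemma spread_imp_long_path:
  assumes "spread E V \<psi>"
  obtains ys where "dpath E ys" "set ys \<subseteq> V" "exp \<psi> \<le> real (length ys)"
proof -
  obtain Q p where ps: "path_system E V Q p" and sp: "spreads E Q p \<psi>"
    using assms by (auto simp: spread_def)
  have dp: "disjoint_paths E V Q" and ppos: "\<And>x. x \<in> set Q \<Longrightarrow> p x > 0" and psum: "(\<Sum>x\<in>set Q. p x) = 1"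
    using ps by (auto simp: path_system_def)
  obtain s where adm: "admissible E s Q"
    and P: "\<And>x u. x \<in> set Q \<Longrightarrow> u \<in> tl_part x \<Longrightarrow> \<exists>ys. dpath E ys \<and> ys \<noteq> [] \<and>
     last ys = u \<and> set ys \<subseteq> \<Union>(set ` set Q) \<and> s x + wt x \<le> length ys"
    using ex_admissible[OF dp] by blast
  obtain a where apos: "\<And>x. x \<in> set Q \<Longrightarrow> a x > 0" and kraft: "\<And>t. (\<Sum>x\<in>active s t Q. a x) \<le> 1"
    and psi: "\<psi> \<le> (\<Sum>x\<in>set Q. p x * ln (real (wt x) * a x / p x))"
    using sp adm unfolding spreads_def by metis
  have ne: "set Q \<noteq> {}" using psum by auto
  have nonempty: "x \<noteq> []" if "x \<in> set Q" for x using dp that by (auto simp: disjoint_paths_def)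
  define L where "L = Max ((\<lambda>x. s x + wt x) ` set Q)"
  have L: "s x + wt x \<le> L" if "x \<in> set Q" for x using that by (simp add: L_def)
  have "L \<in> (\<lambda>x. s x + wt x) ` set Q" unfolding L_def using ne by (intro Max_in) auto
  then obtain x0 where x0: "x0 \<in> set Q" "L = s x0 + wt x0" by auto
  obtain u0 where "u0 \<in> tl_part x0" using parts_nonempty[OF nonempty[OF x0(1)]] by blast
  then obtain ys where ys: "dpath E ys" "set ys \<subseteq> \<Union>(set ` set Q)" "L \<le> length ys"
    using P[OF x0(1)] x0(2) by metis
  have Lpos: "0 < L" using x0 wt_bounds[OF nonempty[OF x0(1)]] by simp
  \<comment> \<open>Double counting of pairs of an item and a point covered by it.\<close>
  have "(\<Sum>x\<in>set Q. real (wt x) * a x) = (\<Sum>x\<in>set Q. \<Sum>t<L. a x * of_bool (s x \<le> t \<and> t < s x + wt x))"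
  proof (rule sum.cong[OF refl])
    fix x assume "x \<in> set Q"
    then have "{t\<in>{..<L}. s x \<le> t \<and> t < s x + wt x} = {s x..<s x + wt x}" using L[of x] by auto
    then show "real (wt x) * a x = (\<Sum>t<L. a x * of_bool (s x \<le> t \<and> t < s x + wt x))"
      by (simp add: of_bool_def sum.If_cases Int_def if_distrib cong: if_cong)
  qed
  also have "\<dots> = (\<Sum>t<L. \<Sum>x\<in>set Q. a x * of_bool (s x \<le> t \<and> t < s x + wt x))"
    by (rule sum.swap)
  also have "\<dots> = (\<Sum>t<L. \<Sum>x\<in>active s t Q. a x)"
    by (intro sum.cong[OF refl] sum.mono_neutral_cong_right) (auto simp: active_def)
  also have "\<dots> \<le> (\<Sum>t<L. 1)" by (intro sum_mono kraft)
  finally have tot: "(\<Sum>x\<in>set Q. real (wt x) * a x) \<le> real L" by simp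
  have "(\<Sum>x\<in>set Q. p x * ln (real (wt x) * a x / p x)) \<le>
        (\<Sum>x\<in>set Q. real (wt x) * a x / real L + p x * (ln (real L) - 1))"
  proof (rule sum_mono)
    fix x assume x: "x \<in> set Q"
    define z where "z = real (wt x) * a x / p x"
    have zpos: "z > 0" using wt_bounds[OF nonempty[OF x]] apos[OF x] ppos[OF x] by (simp add: z_def)
    \<comment> \<open>Jensen's inequality by way of the tangent to \<open>ln\<close> at
      \<open>L\<close>.\<close>
    have "ln (z / real L) \<le> z / real L - 1" using zpos Lpos by (intro ln_le_minus_one) simp
    then have "ln z \<le> z / real L + (ln (real L) - 1)" using zpos Lpos by (simp add: ln_div)
    then have "p x * ln z \<le> p x * (z / real L + (ln (real L) - 1))" using ppos[OF x] by simp
    also have "\<dots> = real (wt x) * a x / real L + p x * (ln (real L) - 1)"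
      using ppos[OF x] by (simp add: z_def distrib_left)
    finally show "p x * ln (real (wt x) * a x / p x) \<le> real (wt x) * a x / real L + p x * (ln (real L) - 1)"
      by (simp add: z_def)
  qed
  also have "\<dots> = (\<Sum>x\<in>set Q. real (wt x) * a x) / real L + (\<Sum>x\<in>set Q. p x) * (ln (real L) - 1)"
    by (simp add: sum.distrib sum_divide_distrib sum_distrib_right)
  also have "\<dots> \<le> ln (real L)" using tot Lpos psum by (simp add: field_simps)
  finally have "\<psi> \<le> ln (real L)" using psi by simp
  then have "exp \<psi> \<le> real L" using Lpos by (simp add: ln_ge_iff)
  then have "exp \<psi> \<le> real (length ys)" using ys(3) by linarith
  moreover have "set ys \<subseteq> V" using ys(2) dp by (fastforce simp: disjoint_paths_def)
  ultimately show ?thesis using that ys(1) by blast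
qed

section \<open>Uniform systems of paths of equal length\<close>

lemma disjoint_paths_distinct:
  assumes "disjoint_paths E V Q"
  shows "distinct Q" "\<And>x y. x \<in> set Q \<Longrightarrow> y \<in> set Q \<Longrightarrow> x \<noteq> y \<Longrightarrow> set x \<inter> set y = {}"
proof -
  have "distinct Q \<and> (\<forall>x\<in>set Q. \<forall>y\<in>set Q. x \<noteq> y \<longrightarrow> set x \<inter> set y = {})"
    using assms
  proof (induction Q)
    case (Cons x Q)
    then have *: "disjoint_paths E V Q" "x \<noteq> []" "\<forall>y\<in>set Q. set x \<inter> set y = {}"
      by (auto simp: disjoint_paths_def)
    then have "x \<notin> set Q" by auto
    then show ?case using Cons.IH[OF *(1)] *(3) by auto
  qed simp
  then show "distinct Q" "\<And>x y. x \<in> set Q \<Longrightarrow> y \<in> set Q \<Longrightarrow> x \<noteq> y \<Longrightarrow> set x \<inter> set y = {}"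
    by blast+
qed

lemma sum_of_bool_le_single:
  fixes c :: real
  assumes "finite S" "0 \<le> c" "\<And>x y. x \<in> S \<Longrightarrow> y \<in> S \<Longrightarrow> R x \<Longrightarrow> R y \<Longrightarrow> x = y"
  shows "(\<Sum>x\<in>S. c * of_bool (R x)) \<le> c"
proof (cases "\<exists>x\<in>S. R x")
  case True
  then obtain x where x: "x \<in> S" "R x" by blast
  then have "(\<Sum>x\<in>S. c * of_bool (R x)) = (\<Sum>x\<in>{x}. c * of_bool (R x))"
    using assms by (intro sum.mono_neutral_right) auto
  then show ?thesis using x by simp
next
  case False
  then have "(\<Sum>x\<in>S. c * of_bool (R x)) = 0" by (intro sum.neutral) auto
  then show ?thesis using assms(2) by (simp only:)
qed

text \<open>Take the uniform distribution and Kraft weights equal to the probabilities: the Kraft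
  sums are then at most 1 whatever the positions, and the potential is just the logarithm of the
  common \<open>wt\<close>. In the hitting bound 6, a factor 2 comes from covering half of
  \<open>V\<close> and a factor 3 from using thirds.\<close>

lemma spread_disjoint_paths:
  assumes fin: "finite V" "V \<noteq> {}" and dp: "disjoint_paths E V Q"
    and len: "\<And>x. x \<in> set Q \<Longrightarrow> length x = l" and cover: "card V \<le> 2 * (length Q * l)"
  shows "spread E V (ln (real (l + 2 - 2 * ((l + 2) div 3))))"
proof -
  have Vpos: "0 < card V" using fin by (simp add: card_gt_0_iff)
  then have pos: "0 < length Q" "0 < l" using cover by (auto intro!: Nat.gr0I)
  define A where "A = real (length Q)"
  have A: "A > 0" using pos by (simp add: A_def)
  have cardQ: "real (card (set Q)) = A" using disjoint_paths_distinct(1)[OF dp] by (simp add: A_def distinct_card)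
  have th: "third x = (l + 2) div 3" and w: "wt x = l + 2 - 2 * ((l + 2) div 3)" if "x \<in> set Q" for x
    using len[OF that] by (auto simp: third_def wt_def)
  have thl: "l \<le> 3 * ((l + 2) div 3)" by linarith
  have bnd: "1 / A / real ((l + 2) div 3) \<le> 6 / real (card V)"
  proof -
    have "real (card V) \<le> 2 * (A * real l)" using cover unfolding A_def by (metis of_nat_mono of_nat_mult of_nat_numeral)
    also have "\<dots> \<le> 2 * (A * (3 * real ((l + 2) div 3)))"
    proof (intro mult_left_mono)
      show "real l \<le> 3 * real ((l + 2) div 3)" using thl by (metis of_nat_mono of_nat_mult of_nat_numeral)
    qed (use A in auto)
    finally have "real (card V) \<le> 6 * (A * real ((l + 2) div 3))" by simp
    moreover have "0 < (l + 2) div 3" using pos by linarith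
    ultimately show ?thesis using A Vpos by (simp add: field_simps)
  qed
  have part: "(\<Sum>x\<in>set Q. (1 / A) / real (third x) * of_bool (u \<in> f x)) \<le> 6 / real (card V)"
    if "\<And>x. f x \<subseteq> set x" for f u
  proof -
    have "(\<Sum>x\<in>set Q. (1 / A) / real (third x) * of_bool (u \<in> f x)) =
          (\<Sum>x\<in>set Q. (1 / A / real ((l + 2) div 3)) * of_bool (u \<in> f x))"
      by (intro sum.cong refl) (simp add: th)
    also have "\<dots> \<le> 1 / A / real ((l + 2) div 3)"
      using A disjoint_paths_distinct(2)[OF dp] that by (intro sum_of_bool_le_single) (auto, blast)
    finally show ?thesis using bnd by linarith
  qed
  have "path_system E V Q (\<lambda>_. 1 / A)"
    unfolding path_system_def using dp A cardQ part[OF hd_part_subset] part[OF tl_part_subset] by simp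
  moreover have "spreads E Q (\<lambda>_. 1 / A) (ln (real (l + 2 - 2 * ((l + 2) div 3))))"
    unfolding spreads_def
  proof (intro allI impI exI[of _ "\<lambda>_. 1 / A"] conjI ballI)
    fix s t
    have "real (card (active s t Q)) \<le> real (card (set Q))"
      by (intro of_nat_mono card_mono) (auto simp: active_def)
    then show "(\<Sum>x\<in>active s t Q. 1 / A) \<le> 1" using A cardQ by (simp add: field_simps)
    show "ln (real (l + 2 - 2 * ((l + 2) div 3))) \<le> (\<Sum>x\<in>set Q. 1 / A * ln (real (wt x) * (1 / A) / (1 / A)))"
      using A by (simp add: w cardQ del: of_nat_diff)
  qed (use A in auto)
  ultimately show ?thesis unfolding spread_def by blast
qed

text \<open>The fallback potential for colours about which nothing better is known.\<close>

lemma spread_singletons: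
  assumes "finite V" "V \<noteq> {}"
  shows "spread E V 0"
proof -
  obtain vs where vs: "set vs = V" "distinct vs" using finite_distinct_list[OF assms(1)] by blast
  have "disjoint_paths E V (map (\<lambda>v. [v]) vs)"
    using vs by (auto simp: disjoint_paths_def dpath_def sorted_wrt_map distinct_conv_nth sorted_wrt_iff_nth_less)
  moreover have "card V \<le> 2 * (length (map (\<lambda>v. [v]) vs) * 1)"
    using vs distinct_card[of vs] by simp
  ultimately have "spread E V (ln (real (1 + 2 - 2 * ((1 + 2) div 3))))"
    by (intro spread_disjoint_paths[OF assms]) auto
  then show ?thesis by simp
qed

lemma spread_mono: "spread E V \<psi> \<Longrightarrow> \<phi> \<le> \<psi> \<Longrightarrow> spread E V \<phi>"
  unfolding spread_def spreads_def by (meson order_trans)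

section \<open>Mixtures of path systems on disjoint pieces\<close>

lemma sorted_wrt_concat_upt:
  "sorted_wrt R (concat (map Q [0..<m])) \<longleftrightarrow> (\<forall>k<m. sorted_wrt R (Q k)) \<and>
     (\<forall>l<m. \<forall>k<l. \<forall>x\<in>set (Q k). \<forall>y\<in>set (Q l). R x y)"
  by (induction m) (auto simp: sorted_wrt_append less_Suc_eq)

text \<open>The systems of the pieces are concatenated in the order of the pieces, and piece
  \<open>k\<close> is drawn with probability \<open>lam k\<close> proportional to its size.\<close>

locale path_mixture =
  fixes E :: "'a \<Rightarrow> 'a \<Rightarrow> bool" and m :: nat and V :: "nat \<Rightarrow> 'a set"
    and Q :: "nat \<Rightarrow> 'a list list" and p :: "nat \<Rightarrow> 'a list \<Rightarrow> real"
  assumes m: "0 < m" and fin: "\<And>k. k < m \<Longrightarrow> finite (V k)" and ne: "\<And>k. k < m \<Longrightarrow> V k \<noteq> {}"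
    and disj: "\<And>k l. k < m \<Longrightarrow> l < m \<Longrightarrow> k \<noteq> l \<Longrightarrow> V k \<inter> V l = {}"
    and sys: "\<And>k. k < m \<Longrightarrow> path_system E (V k) (Q k) (p k)"
begin

definition U :: "'a set" where "U = (\<Union>k<m. V k)"

definition lam :: "nat \<Rightarrow> real" where "lam k = real (card (V k)) / real (card U)"

definition QQ :: "'a list list" where "QQ = concat (map Q [0..<m])"

definition idx :: "'a list \<Rightarrow> nat" where "idx x = (THE k. k < m \<and> x \<in> set (Q k))"

definition P :: "'a list \<Rightarrow> real" where "P x = lam (idx x) * p (idx x) x"

lemma dpQ: "k < m \<Longrightarrow> disjoint_paths E (V k) (Q k)"
  using sys by (simp add: path_system_def)

lemma in_Q: "k < m \<Longrightarrow> x \<in> set (Q k) \<Longrightarrow> x \<noteq> [] \<and> set x \<subseteq> V k \<and> dpath E x"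
  using dpQ by (auto simp: disjoint_paths_def)

lemma p_pos: "k < m \<Longrightarrow> x \<in> set (Q k) \<Longrightarrow> p k x > 0"
  using sys by (simp add: path_system_def)

lemma p_sum: "k < m \<Longrightarrow> (\<Sum>x\<in>set (Q k). p k x) = 1"
  using sys by (simp add: path_system_def)

lemma Q_disj: "k < m \<Longrightarrow> l < m \<Longrightarrow> x \<in> set (Q k) \<Longrightarrow> x \<in> set (Q l) \<Longrightarrow> k = l"
  using in_Q[of k x] in_Q[of l x] disj[of k l] by (cases x) auto

lemma idx: "k < m \<Longrightarrow> x \<in> set (Q k) \<Longrightarrow> idx x = k"
  unfolding idx_def using Q_disj by blast

lemma set_QQ: "set QQ = (\<Union>k<m. set (Q k))"
  by (auto simp: QQ_def)

lemma sum_QQ: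
  fixes g :: "'a list \<Rightarrow> real"
  shows "(\<Sum>x\<in>set QQ. g x) = (\<Sum>k<m. \<Sum>x\<in>set (Q k). g x)"
  unfolding set_QQ using Q_disj by (intro sum.UNION_disjoint) auto

lemma card_U: "card U = (\<Sum>k<m. card (V k))"
  unfolding U_def using fin disj by (intro card_UN_disjoint) auto

lemma card_V_pos: "k < m \<Longrightarrow> 0 < card (V k)"
  using fin ne by (simp add: card_gt_0_iff)

lemma card_U_pos: "0 < card U"
  unfolding card_U using m card_V_pos by (intro sum_pos) auto

lemma lam_pos: "k < m \<Longrightarrow> 0 < lam k"
  using card_U_pos card_V_pos by (simp add: lam_def)

lemma lam_sum: "(\<Sum>k<m. lam k) = 1"
proof -
  have "(\<Sum>k<m. lam k) = real (\<Sum>k<m. card (V k)) / real (card U)"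
    by (simp add: lam_def sum_divide_distrib)
  then show ?thesis using card_U_pos by (simp only: flip: card_U) simp
qed

lemma lam_le_1: "k < m \<Longrightarrow> lam k \<le> 1"
  using member_le_sum[of k "{..<m}" lam] lam_pos lam_sum by (force simp: less_imp_le)

text \<open>Each vertex meets items of one piece only, and the factor \<open>lam k\<close> turns the
  bound \<open>6 / card (V k)\<close> into exactly \<open>6 / card U\<close>.\<close>

lemma path_system_QQ: "path_system E U QQ P"
proof -
  have "disjoint_paths E U QQ"
    unfolding disjoint_paths_def
  proof (intro conjI ballI)
    fix x assume "x \<in> set QQ"
    then show "x \<noteq> []" "dpath E x" "set x \<subseteq> U" using in_Q by (auto simp: set_QQ U_def) 
  next
    show "sorted_wrt (\<lambda>x y. set x \<inter> set y = {}) QQ"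
      unfolding QQ_def sorted_wrt_concat_upt
    proof (intro conjI allI impI ballI)
      fix k assume "k < m" then show "sorted_wrt (\<lambda>x y. set x \<inter> set y = {}) (Q k)"
        using dpQ by (simp add: disjoint_paths_def)
    next
      fix l k x y assume "l < m" "k < l" "x \<in> set (Q k)" "y \<in> set (Q l)"
      then show "set x \<inter> set y = {}" using in_Q[of k x] in_Q[of l y] disj[of k l] by fastforce
    qed
  qed
  moreover have "\<forall>x\<in>set QQ. P x > 0"
    by (auto simp: set_QQ P_def idx intro!: mult_pos_pos lam_pos p_pos)
  moreover have "(\<Sum>x\<in>set QQ. P x) = 1"
  proof -
    have "(\<Sum>x\<in>set QQ. P x) = (\<Sum>k<m. \<Sum>x\<in>set (Q k). lam k * p k x)"
      unfolding sum_QQ by (intro sum.cong refl) (simp add: P_def idx)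
    then show ?thesis by (simp add: p_sum lam_sum flip: sum_distrib_left)
  qed
  moreover have "(\<Sum>x\<in>set QQ. P x / real (third x) * of_bool (u \<in> f x)) \<le> 6 / real (card U)"
    if u: "u \<in> U" and f: "\<And>x. f x \<subseteq> set x" and
      dom: "\<And>k u. k < m \<Longrightarrow> u \<in> V k \<Longrightarrow> (\<Sum>x\<in>set (Q k). p k x / real (third x) * of_bool (u \<in> f x)) \<le> 6 / real (card (V k))"
    for u f
  proof -
    obtain k0 where k0: "k0 < m" "u \<in> V k0" using u by (auto simp: U_def)
    have "(\<Sum>x\<in>set QQ. P x / real (third x) * of_bool (u \<in> f x)) =
      (\<Sum>k<m. lam k * (\<Sum>x\<in>set (Q k). p k x / real (third x) * of_bool (u \<in> f x)))"
      unfolding sum_QQ sum_distrib_left by (intro sum.cong refl) (simp add: P_def idx)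
    also have "\<dots> = (\<Sum>k\<in>{k0}. lam k * (\<Sum>x\<in>set (Q k). p k x / real (third x) * of_bool (u \<in> f x)))"
    proof (intro sum.mono_neutral_right ballI)
      fix k assume k: "k \<in> {..<m} - {k0}"
      have "u \<notin> f x" if "x \<in> set (Q k)" for x using k k0 in_Q[of k x] that f[of x] disj[of k k0] by blast
      then show "lam k * (\<Sum>x\<in>set (Q k). p k x / real (third x) * of_bool (u \<in> f x)) = 0" by simp
    qed (use k0 in auto)
    also have "\<dots> \<le> lam k0 * (6 / real (card (V k0)))"
      using mult_left_mono[OF dom[OF k0], of "lam k0"] lam_pos[OF k0(1)] by simp
    also have "\<dots> = 6 / real (card U)" using card_V_pos[OF k0(1)] by (simp add: lam_def)
    finally show ?thesis .
  qed
  ultimately show ?thesis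
    using sys unfolding path_system_def by (simp add: hd_part_subset tl_part_subset)
qed

lemma admissible_Q: "admissible E s QQ \<Longrightarrow> k < m \<Longrightarrow> admissible E s (Q k)"
  by (simp add: admissible_def QQ_def sorted_wrt_concat_upt)

lemma admissible_cross:
  "admissible E s QQ \<Longrightarrow> k < l \<Longrightarrow> l < m \<Longrightarrow> x \<in> set (Q k) \<Longrightarrow> y \<in> set (Q l) \<Longrightarrow> linked E x y \<Longrightarrow> s x + wt x \<le> s y"
  by (simp add: admissible_def QQ_def sorted_wrt_concat_upt)

text \<open>Kraft weights of the pieces are multiplied by factors \<open>c x\<close>. If at each
  point the factors of active items in piece \<open>k\<close> are at most \<open>b k\<close>, with
  the \<open>b k\<close> summing to at most 1, the Kraft inequality is inherited. In the potential,
  mixing contributes \<open>- ln (lam k)\<close> and the factors contribute the mean of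
  \<open>ln (c x)\<close>, so only a choice of \<open>c\<close> remains.\<close>

lemma spreads_QQ:
  assumes sp: "\<And>k. k < m \<Longrightarrow> spreads E (Q k) (p k) (\<psi> k)"
    and c: "\<And>s. admissible E s QQ \<Longrightarrow> \<exists>c. (\<forall>x\<in>set QQ. c x > 0) \<and>
      (\<forall>t. \<exists>b. (\<Sum>k<m. b k) \<le> 1 \<and> (\<forall>k<m. 0 \<le> b k \<and> (\<forall>x\<in>active s t (Q k). c x \<le> b k))) \<and>
      \<Psi> \<le> (\<Sum>k<m. lam k * (\<psi> k - ln (lam k) + (\<Sum>x\<in>set (Q k). p k x * ln (c x))))"
  shows "spreads E QQ P \<Psi>"
  unfolding spreads_def
proof (intro allI impI)
  fix s assume adm: "admissible E s QQ"
  define F where "F k a \<longleftrightarrow> (\<forall>x\<in>set (Q k). a x > 0) \<and> (\<forall>t. (\<Sum>x\<in>active s t (Q k). a x) \<le> 1) \<and>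
     \<psi> k \<le> (\<Sum>x\<in>set (Q k). p k x * ln (real (wt x) * a x / p k x))" for k a
  have "\<forall>k. \<exists>a. k < m \<longrightarrow> F k a"
    using sp admissible_Q[OF adm] unfolding spreads_def F_def by blast
  from choice[OF this] obtain a where "\<forall>k. k < m \<longrightarrow> F k (a k)" ..
  then have apos: "\<And>k x. k < m \<Longrightarrow> x \<in> set (Q k) \<Longrightarrow> a k x > 0"
    and kraft: "\<And>k t. k < m \<Longrightarrow> (\<Sum>x\<in>active s t (Q k). a k x) \<le> 1"
    and psi: "\<And>k. k < m \<Longrightarrow> \<psi> k \<le> (\<Sum>x\<in>set (Q k). p k x * ln (real (wt x) * a k x / p k x))"
    unfolding F_def by blast+
  obtain c where cpos: "\<And>x. x \<in> set QQ \<Longrightarrow> c x > 0"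
    and cb: "\<And>t. \<exists>b. (\<Sum>k<m. b k) \<le> 1 \<and> (\<forall>k<m. 0 \<le> b k \<and> (\<forall>x\<in>active s t (Q k). c x \<le> b k))"
    and Psi: "\<Psi> \<le> (\<Sum>k<m. lam k * (\<psi> k - ln (lam k) + (\<Sum>x\<in>set (Q k). p k x * ln (c x))))"
    using c[OF adm] by blast
  have cpos': "c x > 0" if "k < m" "x \<in> set (Q k)" for k x using that cpos by (auto simp: set_QQ)
  define b where "b x = a (idx x) x * c x" for x
  show "\<exists>a. (\<forall>x\<in>set QQ. 0 < a x) \<and> (\<forall>t. sum a (active s t QQ) \<le> 1) \<and>
             \<Psi> \<le> (\<Sum>x\<in>set QQ. P x * ln (real (wt x) * a x / P x))"
  proof (intro exI[of _ b] conjI ballI allI)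
    fix x assume "x \<in> set QQ"
    then show "0 < b x" using apos cpos' by (auto simp: b_def set_QQ idx)
  next
    fix t
    obtain d where d: "(\<Sum>k<m. d k) \<le> 1" "\<And>k. k < m \<Longrightarrow> 0 \<le> d k"
      "\<And>k x. k < m \<Longrightarrow> x \<in> active s t (Q k) \<Longrightarrow> c x \<le> d k" using cb[of t] by blast
    have "active s t QQ = (\<Union>k<m. active s t (Q k))" by (auto simp: active_def set_QQ)
    then have "sum b (active s t QQ) = (\<Sum>k<m. \<Sum>x\<in>active s t (Q k). b x)"
      using Q_disj by (simp only:) (intro sum.UNION_disjoint; force simp: active_def)
    also have "\<dots> \<le> (\<Sum>k<m. d k)"
    proof (rule sum_mono)
      fix k assume "k \<in> {..<m}" then have k: "k < m" by simp
      have "(\<Sum>x\<in>active s t (Q k). b x) \<le> (\<Sum>x\<in>active s t (Q k). a k x * d k)"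
      proof (rule sum_mono)
        fix x assume x: "x \<in> active s t (Q k)"
        then have "x \<in> set (Q k)" by (simp add: active_def)
        then show "b x \<le> a k x * d k"
          using d(3)[OF k x] apos[OF k] k by (simp add: b_def idx mult_left_mono less_imp_le)
      qed
      also have "\<dots> = (\<Sum>x\<in>active s t (Q k). a k x) * d k" by (simp add: sum_distrib_right)
      also have "\<dots> \<le> 1 * d k" using kraft[OF k] d(2)[OF k] by (intro mult_right_mono)
      finally show "(\<Sum>x\<in>active s t (Q k). b x) \<le> d k" by simp
    qed
    finally show "sum b (active s t QQ) \<le> 1" using d(1) by linarith
  next
    have "(\<Sum>k<m. lam k * (\<psi> k - ln (lam k) + (\<Sum>x\<in>set (Q k). p k x * ln (c x)))) \<le>
      (\<Sum>k<m. \<Sum>x\<in>set (Q k). P x * ln (real (wt x) * b x / P x))"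
    proof (rule sum_mono)
      fix k assume "k \<in> {..<m}" then have k: "k < m" by simp
      have "lam k * (\<psi> k - ln (lam k) + (\<Sum>x\<in>set (Q k). p k x * ln (c x))) \<le>
         lam k * ((\<Sum>x\<in>set (Q k). p k x * ln (real (wt x) * a k x / p k x)) - ln (lam k) + (\<Sum>x\<in>set (Q k). p k x * ln (c x)))"
        using psi[OF k] lam_pos[OF k] by (intro mult_left_mono) auto
      also have "\<dots> = lam k * ((\<Sum>x\<in>set (Q k). p k x * ln (real (wt x) * a k x / p k x)) - ln (lam k) * (\<Sum>x\<in>set (Q k). p k x) + (\<Sum>x\<in>set (Q k). p k x * ln (c x)))"
        by (simp add: p_sum[OF k])
      also have "\<dots> = (\<Sum>x\<in>set (Q k). lam k * (p k x * (ln (real (wt x) * a k x / p k x) - ln (lam k) + ln (c x))))"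
        by (simp add: sum_distrib_left sum.distrib sum_subtractf algebra_simps)
      also have "\<dots> = (\<Sum>x\<in>set (Q k). P x * ln (real (wt x) * b x / P x))"
      proof (intro sum.cong refl)
        fix x assume x: "x \<in> set (Q k)"
        have pos: "0 < real (wt x)" "0 < a k x" "0 < p k x" "0 < c x" "0 < lam k"
          using wt_bounds in_Q[OF k x] apos[OF k x] p_pos[OF k x] cpos'[OF k x] lam_pos[OF k] by auto
        have "ln (real (wt x) * b x / P x) = ln ((real (wt x) * a k x / p k x) / lam k * c x)"
          using pos by (simp add: b_def P_def idx[OF k x] field_simps)
        also have "\<dots> = ln (real (wt x) * a k x / p k x) - ln (lam k) + ln (c x)"
          using pos by (subst ln_mult_pos, simp, simp, subst ln_divide_pos, auto)
        finally show "lam k * (p k x * (ln (real (wt x) * a k x / p k x) - ln (lam k) + ln (c x))) = P x * ln (real (wt x) * b x / P x)"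
          by (simp add: P_def idx[OF k x])
      qed
      finally show "lam k * (\<psi> k - ln (lam k) + (\<Sum>x\<in>set (Q k). p k x * ln (c x))) \<le> (\<Sum>x\<in>set (Q k). P x * ln (real (wt x) * b x / P x))" .
    qed
    then show "\<Psi> \<le> (\<Sum>x\<in>set QQ. P x * ln (real (wt x) * b x / P x))" using Psi unfolding sum_QQ by linarith
  qed
qed

text \<open>With the factor \<open>lam k\<close> on all items of piece \<open>k\<close>, the entropy
  of the mixture cancels and the average potential is left.\<close>

lemma spread_unordered:
  assumes sp: "\<And>k. k < m \<Longrightarrow> spreads E (Q k) (p k) (\<psi> k)"
  shows "spread E U (\<Sum>k<m. lam k * \<psi> k)"
proof -
  have "spreads E QQ P (\<Sum>k<m. lam k * \<psi> k)"
  proof (rule spreads_QQ[OF sp])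
    fix s
    have "(\<Sum>k<m. lam k * \<psi> k) \<le> (\<Sum>k<m. lam k * (\<psi> k - ln (lam k) + (\<Sum>x\<in>set (Q k). p k x * ln (lam (idx x)))))"
    proof (intro sum_mono)
      fix k assume "k \<in> {..<m}" then have k: "k < m" by simp
      have "(\<Sum>x\<in>set (Q k). p k x * ln (lam (idx x))) = (\<Sum>x\<in>set (Q k). p k x) * ln (lam k)"
        unfolding sum_distrib_right by (intro sum.cong refl) (simp add: idx[OF k])
      then show "lam k * \<psi> k \<le> lam k * (\<psi> k - ln (lam k) + (\<Sum>x\<in>set (Q k). p k x * ln (lam (idx x))))"
        by (simp add: p_sum[OF k])
    qed
    then show "\<exists>c. (\<forall>x\<in>set QQ. c x > 0) \<and>
      (\<forall>t. \<exists>b. (\<Sum>k<m. b k) \<le> 1 \<and> (\<forall>k<m. 0 \<le> b k \<and> (\<forall>x\<in>active s t (Q k). c x \<le> b k))) \<and>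
      (\<Sum>k<m. lam k * \<psi> k) \<le> (\<Sum>k<m. lam k * (\<psi> k - ln (lam k) + (\<Sum>x\<in>set (Q k). p k x * ln (c x))))"
      by (intro exI[of _ "\<lambda>x. lam (idx x)"] conjI allI exI[of _ lam])
        (auto simp: set_QQ active_def idx lam_sum lam_pos less_imp_le)
  qed auto
  then show ?thesis using path_system_QQ unfolding spread_def by blast
qed

end

section \<open>Ordered pieces\<close>

lemma median_exists:
  fixes s :: "'b \<Rightarrow> nat" and p :: "'b \<Rightarrow> real"
  assumes "finite S" "\<And>x. x \<in> S \<Longrightarrow> 0 \<le> p x" "(\<Sum>x\<in>S. p x) = 1"
  shows "\<exists>t. (\<Sum>x\<in>{x\<in>S. s x \<le> t}. p x) \<ge> 1/2 \<and> (\<Sum>x\<in>{x\<in>S. t \<le> s x}. p x) \<ge> 1/2"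
proof -
  let ?G = "\<lambda>t. (\<Sum>x\<in>{x\<in>S. s x \<le> t}. p x) \<ge> 1/2"
  \<comment> \<open>The sum of all positions is a crude upper bound; it only ensures that the least
    \<open>t\<close> exists.\<close>
  have "{x\<in>S. s x \<le> (\<Sum>x\<in>S. s x)} = S" using assms(1) by (auto intro: member_le_sum)
  then have ex: "?G (\<Sum>x\<in>S. s x)" using assms(3) by simp
  define t where "t = (LEAST t. ?G t)"
  have t: "?G t" unfolding t_def by (rule LeastI[of ?G, OF ex])
  have "(\<Sum>x\<in>{x\<in>S. s x < t}. p x) \<le> 1/2"
  proof (cases t)
    case (Suc t')
    then have "\<not> ?G t'" using not_less_Least[of t' ?G] by (simp add: t_def)
    then show ?thesis using Suc by (simp add: less_Suc_eq_le)
  qed simp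
  moreover have "(\<Sum>x\<in>S. p x) = (\<Sum>x\<in>{x\<in>S. s x < t}. p x) + (\<Sum>x\<in>{x\<in>S. t \<le> s x}. p x)"
    using assms(1) by (subst sum.union_disjoint[symmetric]) (auto intro!: sum.cong)
  ultimately show ?thesis using t assms(3) by (intro exI[of _ t]) auto
qed

text \<open>All pairs in the product of \<open>A'\<close> and \<open>B'\<close> are counted on the
  right, and \<open>B'\<close> carries half of the mass. It is used with \<open>N\<close> as absence
  of a link and \<open>B'\<close> as one side of a median.\<close>

lemma mass_without_partner:
  fixes p q :: "'b \<Rightarrow> real"
  assumes "finite A" "finite B" "\<And>x. x \<in> A \<Longrightarrow> 0 \<le> p x" "\<And>y. y \<in> B \<Longrightarrow> 0 \<le> q y"
    and "A' \<subseteq> A" "B' \<subseteq> B" "1/2 \<le> (\<Sum>y\<in>B'. q y)" "\<And>x y. x \<in> A' \<Longrightarrow> y \<in> B' \<Longrightarrow> N x y"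
  shows "(\<Sum>x\<in>A'. p x) \<le> 2 * (\<Sum>x\<in>A. \<Sum>y\<in>B. p x * q y * of_bool (N x y))"
proof -
  have "(\<Sum>x\<in>A'. p x) * (1/2) \<le> (\<Sum>x\<in>A'. p x) * (\<Sum>y\<in>B'. q y)"
    using assms by (intro mult_left_mono sum_nonneg) auto
  also have "\<dots> = (\<Sum>x\<in>A'. \<Sum>y\<in>B'. p x * q y * of_bool (N x y))"
    unfolding sum_product using assms(8) by (intro sum.cong refl) auto
  also have "\<dots> \<le> (\<Sum>x\<in>A'. \<Sum>y\<in>B. p x * q y * of_bool (N x y))"
    using assms by (intro sum_mono sum_mono2) (auto intro!: mult_nonneg_nonneg)
  also have "\<dots> \<le> (\<Sum>x\<in>A. \<Sum>y\<in>B. p x * q y * of_bool (N x y))"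
    using assms by (intro sum_mono2 sum_nonneg) (auto intro!: mult_nonneg_nonneg)
  finally show ?thesis by simp
qed

text \<open>If \<open>i\<close> is the least element of \<open>S\<close> and some \<open>k\<close>
  in \<open>S\<close> exceeds \<open>Suc i\<close>, then
  \<open>r < t (Suc i) \<le> t (k - 1) < r\<close>, a contradiction.\<close>

lemma card_separated_le_2:
  fixes t :: "nat \<Rightarrow> nat"
  assumes mono: "\<And>k. Suc k < m \<Longrightarrow> t k < t (Suc k)"
    and S: "S \<subseteq> {..<m}" "\<And>k. k \<in> S \<Longrightarrow> 0 < k \<Longrightarrow> t (k - 1) < r" "\<And>k. k \<in> S \<Longrightarrow> Suc k < m \<Longrightarrow> r < t (Suc k)"
  shows "card S \<le> 2"
proof (cases "S = {}")
  case False
  have mono': "t i \<le> t j" if "i \<le> j" "j < m" for i j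
    using that
  proof (induction j)
    case (Suc j)
    then show ?case using mono[of j] by (cases "i = Suc j") auto
  qed simp
  have finS: "finite S" using S(1) finite_subset by blast
  define i where "i = Min S"
  have iS: "i \<in> S" using finS False by (simp add: i_def)
  have "S \<subseteq> {i, Suc i}"
  proof
    fix k assume k: "k \<in> S"
    have "i \<le> k" using k finS by (simp add: i_def)
    moreover have "\<not> Suc i < k"
    proof
      assume *: "Suc i < k"
      have "k < m" using S(1) k by auto
      then have "r < t (Suc i)" "t (k - 1) < r" using S(2)[OF k] S(3)[OF iS] * by auto
      moreover have "t (Suc i) \<le> t (k - 1)" using * \<open>k < m\<close> by (intro mono') auto
      ultimately show False by linarith
    qed
    ultimately show "k \<in> {i, Suc i}" by auto
  qed
  then have "card S \<le> card {i, Suc i}" by (intro card_mono) auto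
  then show ?thesis by simp
qed simp

context path_mixture
begin

text \<open>The probability that independent random items of two consecutive pieces are not
  linked.\<close>

definition gap :: "nat \<Rightarrow> real" where
  "gap k = (\<Sum>x\<in>set (Q k). \<Sum>y\<in>set (Q (Suc k)). p k x * p (Suc k) y * of_bool (\<not> linked E x y))"

lemma gap_nonneg: "Suc k < m \<Longrightarrow> 0 \<le> gap k"
  unfolding gap_def using p_pos[of k] p_pos[of "Suc k"]
  by (intro sum_nonneg mult_nonneg_nonneg) (auto intro: less_imp_le)

text \<open>If \<open>x\<close> and \<open>y\<close> are not linked, all pairs from the last third
  of \<open>x\<close> and the first third of \<open>y\<close> are non-edges, so the mass of the item
  pair can be spread over them. After exchanging sums, each non-edge receives at most the product of
  two hitting bounds, which gives \<open>36 = 6 * 6\<close>.\<close>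

lemma gap_le:
  assumes k: "Suc k < m"
  shows "gap k \<le> 36 * real (card {(u, v). u \<in> V k \<and> v \<in> V (Suc k) \<and> \<not> E u v}) / (real (card (V k)) * real (card (V (Suc k))))"
proof -
  let ?A = "V k" and ?B = "V (Suc k)"
  define f where "f x u = p k x / real (third x) * of_bool (u \<in> tl_part x)" for x u
  define g where "g y v = p (Suc k) y / real (third y) * of_bool (v \<in> hd_part y)" for y v
  define N where "N u v = (of_bool (\<not> E u v) :: real)" for u v
  have fin': "finite ?A" "finite ?B" using fin k by auto
  have f_le: "(\<Sum>x\<in>set (Q k). f x u) \<le> 6 / real (card ?A)" if "u \<in> ?A" for u
    using sys[of k] k that unfolding path_system_def f_def by simp
  have g_le: "(\<Sum>y\<in>set (Q (Suc k)). g y v) \<le> 6 / real (card ?B)" if "v \<in> ?B" for v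
    using sys[of "Suc k"] k that unfolding path_system_def g_def by simp
  have f_nonneg: "0 \<le> f x u" if "x \<in> set (Q k)" for x u
    using p_pos[of k x] k that by (simp add: f_def)
  have g_nonneg: "0 \<le> g y v" if "y \<in> set (Q (Suc k))" for y v
    using p_pos[of "Suc k" y] k that by (simp add: g_def)
  have "gap k \<le> (\<Sum>x\<in>set (Q k). \<Sum>y\<in>set (Q (Suc k)). \<Sum>u\<in>?A. \<Sum>v\<in>?B. f x u * g y v * N u v)"
    unfolding gap_def
  proof (intro sum_mono)
    fix x y assume x: "x \<in> set (Q k)" and y: "y \<in> set (Q (Suc k))"
    have x': "x \<noteq> []" "distinct x" "set x \<subseteq> ?A" and y': "y \<noteq> []" "distinct y" "set y \<subseteq> ?B"
      using in_Q[of k x] in_Q[of "Suc k" y] k x y by (auto simp: dpath_def)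
    show "p k x * p (Suc k) y * of_bool (\<not> linked E x y) \<le> (\<Sum>u\<in>?A. \<Sum>v\<in>?B. f x u * g y v * N u v)"
    proof (cases "linked E x y")
      case True
      then show ?thesis using f_nonneg[OF x] g_nonneg[OF y] by (auto intro!: sum_nonneg simp: N_def)
    next
      case False
      have "(\<Sum>u\<in>?A. \<Sum>v\<in>?B. f x u * g y v * N u v) = (\<Sum>u\<in>?A. \<Sum>v\<in>?B. f x u * g y v)"
        using False by (intro sum.cong refl) (auto simp: N_def f_def g_def linked_def)
      also have "\<dots> = (\<Sum>u\<in>?A. f x u) * (\<Sum>v\<in>?B. g y v)" by (simp add: sum_product)
      also have "(\<Sum>u\<in>?A. f x u) = (\<Sum>u\<in>tl_part x. p k x / real (third x))"
        using fin' x' tl_part_subset[of x] by (intro sum.mono_neutral_cong_right) (auto simp: f_def)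
      also have "\<dots> = p k x" using card_parts[OF x'(1,2)] third_pos[OF x'(1)] by simp
      also have "(\<Sum>v\<in>?B. g y v) = (\<Sum>v\<in>hd_part y. p (Suc k) y / real (third y))"
        using fin' y' hd_part_subset[of y] by (intro sum.mono_neutral_cong_right) (auto simp: g_def)
      also have "\<dots> = p (Suc k) y" using card_parts[OF y'(1,2)] third_pos[OF y'(1)] by simp
      finally show ?thesis using False by simp
    qed
  qed
  also have "\<dots> = (\<Sum>x\<in>set (Q k). \<Sum>u\<in>?A. \<Sum>v\<in>?B. \<Sum>y\<in>set (Q (Suc k)). f x u * g y v * N u v)"
    by (rule sum.cong[OF refl], rule trans[OF sum.swap], rule sum.cong[OF refl], rule sum.swap)
  also have "\<dots> = (\<Sum>u\<in>?A. \<Sum>v\<in>?B. \<Sum>x\<in>set (Q k). \<Sum>y\<in>set (Q (Suc k)). f x u * g y v * N u v)"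
    by (rule trans[OF sum.swap], rule sum.cong[OF refl], rule sum.swap)
  also have "\<dots> = (\<Sum>u\<in>?A. \<Sum>v\<in>?B. (\<Sum>x\<in>set (Q k). f x u) * (\<Sum>y\<in>set (Q (Suc k)). g y v) * N u v)"
    unfolding sum_product by (simp only: sum_distrib_right)
  also have "\<dots> \<le> (\<Sum>u\<in>?A. \<Sum>v\<in>?B. (6 / real (card ?A)) * (6 / real (card ?B)) * N u v)"
    using f_le g_le f_nonneg g_nonneg
    by (intro sum_mono mult_right_mono mult_mono sum_nonneg) (auto simp: N_def)
  also have "\<dots> = (6 / real (card ?A)) * (6 / real (card ?B)) * (\<Sum>u\<in>?A. \<Sum>v\<in>?B. N u v)"
    by (simp add: sum_distrib_left)
  also have "(\<Sum>u\<in>?A. \<Sum>v\<in>?B. N u v) = (\<Sum>z\<in>?A \<times> ?B. of_bool (\<not> E (fst z) (snd z)))"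
    by (simp add: N_def sum.cartesian_product case_prod_beta)
  also have "\<dots> = (\<Sum>z\<in>{(u, v). u \<in> ?A \<and> v \<in> ?B \<and> \<not> E u v}. 1)"
    using fin' by (intro sum.mono_neutral_cong_right) auto
  finally show ?thesis by (simp add: field_simps)
qed

text \<open>Compared with \<open>spread_unordered\<close>, the order of the pieces gains the entropy
  of \<open>lam\<close>, up to \<open>ln 3\<close> and a loss caused by missing links. Links confine
  most items of a piece between the medians of its neighbours, so only few pieces compete for a
  point of the line.\<close>

lemma spread_ordered:
  assumes sp: "\<And>k. k < m \<Longrightarrow> spreads E (Q k) (p k) (\<psi> k)"
    and Lam: "\<And>k. k < m \<Longrightarrow> - ln (lam k) \<le> \<Lambda>"
    and e: "(\<Sum>k<m - 1. gap k) \<le> e"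
  shows "spread E U ((\<Sum>k<m. lam k * (\<psi> k - ln (lam k))) - ln 3 - 4 * e * \<Lambda>)"
proof (cases "\<forall>k. Suc k < m \<longrightarrow> gap k < 1/4")
  \<comment> \<open>One large gap makes the loss \<open>4 * e * \<Lambda>\<close> at least
    \<open>\<Lambda>\<close>, which exceeds the whole entropy; the unordered mixture then
    suffices.\<close>
  case False
  then obtain k where k: "Suc k < m" "1/4 \<le> gap k" by force
  have "gap k \<le> (\<Sum>k<m - 1. gap k)" using k gap_nonneg by (intro member_le_sum) auto
  then have "1 \<le> 4 * e" using k e by linarith
  moreover have "0 \<le> \<Lambda>" using Lam[OF m] ln_le_zero_iff[OF lam_pos[OF m]] lam_le_1[OF m] by linarith
  ultimately have "1 * \<Lambda> \<le> 4 * e * \<Lambda>" by (intro mult_right_mono)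
  moreover have "(\<Sum>k<m. lam k * (\<psi> k - ln (lam k))) \<le> (\<Sum>k<m. lam k * \<psi> k + lam k * \<Lambda>)"
    using Lam lam_pos by (intro sum_mono) (auto simp: right_diff_distrib[symmetric] distrib_left[symmetric] intro!: mult_left_mono less_imp_le)
  moreover have "(\<Sum>k<m. lam k * \<psi> k + lam k * \<Lambda>) = (\<Sum>k<m. lam k * \<psi> k) + \<Lambda>"
    by (simp add: sum.distrib lam_sum flip: sum_distrib_right)
  moreover have "0 \<le> ln (3::real)" by simp
  ultimately have "(\<Sum>k<m. lam k * (\<psi> k - ln (lam k))) - ln 3 - 4 * e * \<Lambda> \<le> (\<Sum>k<m. lam k * \<psi> k)" by linarith
  then show ?thesis by (intro spread_mono[OF spread_unordered[OF sp]])
next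
  case small: True
  txt \<open>An item is erroneous if it does not lie between the medians of the two neighbouring pieces. The other items meet a given point
    from at most two pieces, so factor \<open>1/3\<close> suffices for them; erroneous ones pay \<open>lam k / 3\<close>.\<close>
  have "spreads E QQ P ((\<Sum>k<m. lam k * (\<psi> k - ln (lam k))) - ln 3 - 4 * e * \<Lambda>)"
  proof (rule spreads_QQ[OF sp])
    fix s assume adm: "admissible E s QQ"
    have "\<forall>k. \<exists>t. k < m \<longrightarrow> (\<Sum>x\<in>{x\<in>set (Q k). s x \<le> t}. p k x) \<ge> 1/2 \<and> (\<Sum>x\<in>{x\<in>set (Q k). t \<le> s x}. p k x) \<ge> 1/2"
      using median_exists[OF finite_set _ p_sum] p_pos by (meson less_imp_le)
    from choice[OF this] obtain \<tau> where
      low: "\<And>k. k < m \<Longrightarrow> (\<Sum>x\<in>{x\<in>set (Q k). s x \<le> \<tau> k}. p k x) \<ge> 1/2" and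
      high: "\<And>k. k < m \<Longrightarrow> (\<Sum>x\<in>{x\<in>set (Q k). \<tau> k \<le> s x}. p k x) \<ge> 1/2" by blast
    have wpos: "0 < wt x" if "k < m" "x \<in> set (Q k)" for k x using in_Q[OF that] wt_bounds by blast
    have pnn: "0 \<le> p k x" if "k < m" "x \<in> set (Q k)" for k x using p_pos[OF that] by simp
    \<comment> \<open>If the medians failed to increase, no item at or above \<open>\<tau> k\<close>
      could be linked to one at or below \<open>\<tau> (Suc k)\<close>. Half of the mass would then
      be at most \<open>2 * gap k\<close>, which is below one half.\<close>
    have mono: "\<tau> k < \<tau> (Suc k)" if k: "Suc k < m" for k
    proof (rule ccontr)
      assume neg: "\<not> \<tau> k < \<tau> (Suc k)"
      have "(\<Sum>x\<in>{x\<in>set (Q k). \<tau> k \<le> s x}. p k x) \<le> 2 * gap k"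
        unfolding gap_def
      proof (rule mass_without_partner[where B' = "{y\<in>set (Q (Suc k)). s y \<le> \<tau> (Suc k)}"])
        fix x y assume x: "x \<in> {x\<in>set (Q k). \<tau> k \<le> s x}" and y: "y \<in> {y\<in>set (Q (Suc k)). s y \<le> \<tau> (Suc k)}"
        show "\<not> linked E x y"
        proof
          assume "linked E x y"
          then have "s x + wt x \<le> s y" using admissible_cross[OF adm, of k "Suc k" x y] k x y by auto
          then show False using x y neg wpos[of k x] k by auto
        qed
      qed (use k low[of "Suc k"] pnn in auto)
      then show False using small k high[of k] by fastforce
    qed
    \<comment> \<open>Errors are defined by links: \<open>prev\<close> means no link from the upper
      half of the preceding piece, \<open>succ\<close> no link to the lower half of the next one. In
      their absence, admissibility puts the item between the two medians.\<close>
    define prev where "prev k x \<longleftrightarrow> 0 < k \<and> (\<forall>y\<in>set (Q (k - 1)). \<tau> (k - 1) \<le> s y \<longrightarrow> \<not> linked E y x)" for k x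
    define succ where "succ k x \<longleftrightarrow> Suc k < m \<and> (\<forall>y\<in>set (Q (Suc k)). s y \<le> \<tau> (Suc k) \<longrightarrow> \<not> linked E x y)" for k x
    define err where "err k x \<longleftrightarrow> prev k x \<or> succ k x" for k x
    have prev_le: "(\<Sum>x\<in>{x\<in>set (Q (Suc k)). prev (Suc k) x}. p (Suc k) x) \<le> 2 * gap k" if k: "Suc k < m" for k
    proof -
      have "(\<Sum>x\<in>{x\<in>set (Q (Suc k)). prev (Suc k) x}. p (Suc k) x) \<le>
        2 * (\<Sum>x\<in>set (Q (Suc k)). \<Sum>y\<in>set (Q k). p (Suc k) x * p k y * of_bool (\<not> linked E y x))"
        using k high[of k] pnn
        by (intro mass_without_partner[where B' = "{y\<in>set (Q k). \<tau> k \<le> s y}"]) (auto simp: prev_def)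
      also have "\<dots> = 2 * gap k" unfolding gap_def
        by (subst sum.swap) (simp add: mult.commute mult.left_commute)
      finally show ?thesis .
    qed
    have succ_le: "(\<Sum>x\<in>{x\<in>set (Q k). succ k x}. p k x) \<le> 2 * gap k" if k: "Suc k < m" for k
      unfolding gap_def using k low[of "Suc k"] pnn
      by (intro mass_without_partner[where B' = "{y\<in>set (Q (Suc k)). s y \<le> \<tau> (Suc k)}"]) (auto simp: succ_def)
    define pe where "pe k = (\<Sum>x\<in>{x\<in>set (Q k). err k x}. p k x)" for k
    define d where "d k = (if Suc k < m then 2 * gap k else 0)" for k
    have pe_nonneg: "0 \<le> pe k" if "k < m" for k unfolding pe_def using pnn[OF that] by (intro sum_nonneg) auto
    have pe_le: "pe k \<le> (if 0 < k then d (k - 1) else 0) + d k" if k: "k < m" for k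
    proof -
      have "pe k \<le> (\<Sum>x\<in>{x\<in>set (Q k). prev k x} \<union> {x\<in>set (Q k). succ k x}. p k x)"
        unfolding pe_def err_def using pnn[OF k] by (intro sum_mono2) auto
      also have "\<dots> \<le> (\<Sum>x\<in>{x\<in>set (Q k). prev k x}. p k x) + (\<Sum>x\<in>{x\<in>set (Q k). succ k x}. p k x)"
        using pnn[OF k] by (subst sum_Un) (auto intro!: sum_nonneg)
      also have "(\<Sum>x\<in>{x\<in>set (Q k). prev k x}. p k x) \<le> (if 0 < k then d (k - 1) else 0)"
        using prev_le[of "k - 1"] k by (auto simp: d_def prev_def)
      also have "(\<Sum>x\<in>{x\<in>set (Q k). succ k x}. p k x) \<le> d k"
        using succ_le[of k] by (auto simp: d_def succ_def)
      finally show ?thesis by simp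
    qed
    \<comment> \<open>Each gap is charged to two neighbouring pieces, each time with factor
      2.\<close>
    have sum_pe: "(\<Sum>k<m. pe k) \<le> 4 * e"
    proof -
      obtain m' where m': "m = Suc m'" using m by (cases m) auto
      have "(\<Sum>k<m. pe k) \<le> (\<Sum>k<m. if 0 < k then d (k - 1) else 0) + (\<Sum>k<m. d k)"
        unfolding sum.distrib[symmetric] using pe_le by (intro sum_mono) auto
      also have "(\<Sum>k<m. if 0 < k then d (k - 1) else 0) = (\<Sum>k<m'. d k)"
        unfolding m' by (simp add: sum.lessThan_Suc_shift del: sum.lessThan_Suc)
      also have "(\<Sum>k<m. d k) = (\<Sum>k<m'. d k)" by (simp add: m' d_def)
      also have "(\<Sum>k<m'. d k) = 2 * (\<Sum>k<m'. gap k)"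
        unfolding sum_distrib_left by (intro sum.cong) (auto simp: d_def m')
      finally show ?thesis using e by (simp add: m')
    qed
    define c where "c x = (if err (idx x) x then lam (idx x) / 3 else 1/3)" for x
    show "\<exists>c. (\<forall>x\<in>set QQ. c x > 0) \<and>
      (\<forall>t. \<exists>b. (\<Sum>k<m. b k) \<le> 1 \<and> (\<forall>k<m. 0 \<le> b k \<and> (\<forall>x\<in>active s t (Q k). c x \<le> b k))) \<and>
      (\<Sum>k<m. lam k * (\<psi> k - ln (lam k))) - ln 3 - 4 * e * \<Lambda> \<le>
        (\<Sum>k<m. lam k * (\<psi> k - ln (lam k) + (\<Sum>x\<in>set (Q k). p k x * ln (c x))))"
    proof (intro exI[of _ c] conjI allI ballI)
      fix x assume "x \<in> set QQ"
      then show "0 < c x" using lam_pos by (auto simp: c_def set_QQ idx)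
    next
      fix r
      \<comment> \<open>The pieces that have a non-erroneous item covering \<open>r\<close>. There
        are at most two, so the bounds \<open>of_bool (k \<in> S) / 3 + lam k / 3\<close> sum to at
        most \<open>2/3 + 1/3\<close>.\<close>
      define S where "S = {k. k < m \<and> (\<exists>x\<in>active s r (Q k). \<not> err k x)}"
      have "card S \<le> 2"
      proof (rule card_separated_le_2[where t = \<tau> and m = m and r = r])
        show "\<And>k. Suc k < m \<Longrightarrow> \<tau> k < \<tau> (Suc k)" by (rule mono)
      next
        fix k assume "k \<in> S"
        then obtain x where k: "k < m" and x: "x \<in> set (Q k)" "s x \<le> r" "r < s x + wt x" "\<not> err k x"
          by (auto simp: S_def active_def)
        { assume k0: "0 < k"
          then obtain y where y: "y \<in> set (Q (k - 1))" "\<tau> (k - 1) \<le> s y" "linked E y x"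
            using x(4) unfolding err_def prev_def by blast
          have "s y + wt y \<le> s x" using k0 k by (intro admissible_cross[OF adm _ k y(1) x(1) y(3)]) simp
          moreover have "0 < wt y" using k by (intro wpos[OF _ y(1)]) simp
          ultimately show "\<tau> (k - 1) < r" using x(2) y(2) by linarith }
        { assume k1: "Suc k < m"
          then obtain y where y: "y \<in> set (Q (Suc k))" "s y \<le> \<tau> (Suc k)" "linked E x y"
            using x(4) unfolding err_def succ_def by blast
          have "s x + wt x \<le> s y" by (rule admissible_cross[OF adm _ k1 x(1) y(1) y(3)]) simp
          then show "r < \<tau> (Suc k)" using x(3) y(2) by linarith }
      qed (auto simp: S_def)
      moreover have "(\<Sum>k<m. of_bool (k \<in> S) / 3) = real (card S) / 3"
      proof -
        have "{..<m} \<inter> S = S" by (auto simp: S_def)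
        then show ?thesis by (simp flip: sum_divide_distrib)
      qed
      ultimately have "(\<Sum>k<m. of_bool (k \<in> S) / 3 + lam k / 3) \<le> 1"
        by (simp add: sum.distrib lam_sum flip: sum_divide_distrib)
      moreover have "c x \<le> of_bool (k \<in> S) / 3 + lam k / 3" if k: "k < m" and x: "x \<in> active s r (Q k)" for k x
        using x k lam_pos[OF k] idx[OF k, of x] by (auto simp: c_def S_def active_def)
      ultimately show "\<exists>b. (\<Sum>k<m. b k) \<le> 1 \<and> (\<forall>k<m. 0 \<le> b k \<and> (\<forall>x\<in>active s r (Q k). c x \<le> b k))"
        using lam_pos by (intro exI[of _ "\<lambda>k. of_bool (k \<in> S) / 3 + lam k / 3"]) (auto simp: less_imp_le)
    next
      \<comment> \<open>Every item pays \<open>ln 3\<close>; an erroneous one pays a further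
        \<open>- ln (lam k) \<le> \<Lambda>\<close>.\<close>
      have lnc: "- ln 3 - \<Lambda> * pe k \<le> (\<Sum>x\<in>set (Q k). p k x * ln (c x))" if k: "k < m" for k
      proof -
        have pe_eq: "pe k = (\<Sum>x\<in>set (Q k). if err k x then p k x else 0)"
          unfolding pe_def by (simp add: sum.inter_filter)
        have "(\<Sum>x\<in>set (Q k). p k x * ln (c x)) = (\<Sum>x\<in>set (Q k). - ln 3 * p k x + ln (lam k) * (if err k x then p k x else 0))"
          using lam_pos[OF k] by (intro sum.cong refl) (auto simp: c_def idx[OF k] ln_div algebra_simps)
        also have "\<dots> = - ln 3 * (\<Sum>x\<in>set (Q k). p k x) + ln (lam k) * pe k"
          unfolding pe_eq by (simp only: sum.distrib sum_distrib_left)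
        finally have "(\<Sum>x\<in>set (Q k). p k x * ln (c x)) = - ln 3 + ln (lam k) * pe k"
          by (simp add: p_sum[OF k])
        moreover have "- ln (lam k) * pe k \<le> \<Lambda> * pe k" by (rule mult_right_mono[OF Lam[OF k] pe_nonneg[OF k]])
        ultimately show ?thesis by linarith
      qed
      have "(\<Sum>k<m. lam k * (\<psi> k - ln (lam k))) - ln 3 - 4 * e * \<Lambda> \<le>
        (\<Sum>k<m. lam k * (\<psi> k - ln (lam k))) - ln 3 - \<Lambda> * (\<Sum>k<m. pe k)"
      proof -
        have "0 \<le> \<Lambda>" using Lam[OF m] ln_le_zero_iff[OF lam_pos[OF m]] lam_le_1[OF m] by linarith
        from mult_left_mono[OF sum_pe this] show ?thesis by (simp add: mult_ac)
      qed
      also have "\<dots> \<le> (\<Sum>k<m. lam k * (\<psi> k - ln (lam k)) - lam k * ln 3 - \<Lambda> * (lam k * pe k))"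
      proof -
        have "0 \<le> \<Lambda>" using Lam[OF m] ln_le_zero_iff[OF lam_pos[OF m]] lam_le_1[OF m] by linarith
        moreover have "(\<Sum>k<m. lam k * pe k) \<le> (\<Sum>k<m. pe k)"
          using lam_le_1 pe_nonneg by (intro sum_mono mult_left_le_one_le) (auto simp: lam_pos less_imp_le)
        ultimately have "\<Lambda> * (\<Sum>k<m. lam k * pe k) \<le> \<Lambda> * (\<Sum>k<m. pe k)" by (rule mult_left_mono[rotated])
        moreover have "(\<Sum>k<m. lam k * ln 3) = ln 3" by (simp add: lam_sum flip: sum_distrib_right)
        ultimately show ?thesis by (simp add: sum_subtractf sum_distrib_left)
      qed
      also have "\<dots> \<le> (\<Sum>k<m. lam k * (\<psi> k - ln (lam k) + (\<Sum>x\<in>set (Q k). p k x * ln (c x))))"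
      proof (intro sum_mono)
        fix k assume "k \<in> {..<m}" then have k: "k < m" by simp
        show "lam k * (\<psi> k - ln (lam k)) - lam k * ln 3 - \<Lambda> * (lam k * pe k) \<le> lam k * (\<psi> k - ln (lam k) + (\<Sum>x\<in>set (Q k). p k x * ln (c x)))"
          using mult_left_mono[OF lnc[OF k], of "lam k"] lam_pos[OF k] by (simp add: algebra_simps)
      qed
      finally show "(\<Sum>k<m. lam k * (\<psi> k - ln (lam k))) - ln 3 - 4 * e * \<Lambda> \<le>
        (\<Sum>k<m. lam k * (\<psi> k - ln (lam k) + (\<Sum>x\<in>set (Q k). p k x * ln (c x))))" .
    qed
  qed auto
  then show ?thesis using path_system_QQ unfolding spread_def by blast
qed

end

lemma spread_union:
  assumes fin: "finite X" "X \<noteq> {}" "finite Y" "Y \<noteq> {}" and disj: "X \<inter> Y = {}"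
    and sp: "spread E X a" "spread E Y b"
  shows "spread E (X \<union> Y) (real (card X) / real (card (X \<union> Y)) * a + real (card Y) / real (card (X \<union> Y)) * b)"
proof -
  obtain QX pX where X: "path_system E X QX pX" "spreads E QX pX a" using sp by (auto simp: spread_def)
  obtain QY pY where Y: "path_system E Y QY pY" "spreads E QY pY b" using sp by (auto simp: spread_def)
  interpret path_mixture E 2 "\<lambda>k. if k = 0 then X else Y" "\<lambda>k. if k = 0 then QX else QY" "\<lambda>k. if k = 0 then pX else pY"
    by standard (use X Y assms in \<open>auto split: if_splits\<close>)
  have "U = X \<union> Y" unfolding U_def by (auto simp: lessThan_Suc numeral_2_eq_2)
  moreover have "spread E U (\<Sum>k<2. lam k * (if k = 0 then a else b))"
    by (rule spread_unordered) (use X Y in auto)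
  moreover have "(\<Sum>k<2. lam k * (if k = 0 then a else b)) = lam 0 * a + lam 1 * b"
    unfolding numeral_2_eq_2 by simp
  ultimately show ?thesis by (simp add: lam_def)
qed

text \<open>Restates the ordered mixture in terms of sizes and non-edge counts:
  \<open>gap_le\<close> bounds the gaps, and \<open>ln B\<close> bounds the entropy of a single
  piece.\<close>

lemma spread_ordered_pieces:
  fixes V :: "nat \<Rightarrow> 'a set" and B :: real
  assumes m: "0 < m" and fin: "\<And>k. k < m \<Longrightarrow> finite (V k)" and ne: "\<And>k. k < m \<Longrightarrow> V k \<noteq> {}"
    and disj: "\<And>k l. k < m \<Longrightarrow> l < m \<Longrightarrow> k \<noteq> l \<Longrightarrow> V k \<inter> V l = {}"
    and sp: "\<And>k. k < m \<Longrightarrow> spread E (V k) (\<psi> k)"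
    and U: "U = (\<Union>k<m. V k)"
    and B: "\<And>k. k < m \<Longrightarrow> real (card U) \<le> B * real (card (V k))"
    and e: "(\<Sum>k<m - 1. 36 * real (card {(u, v). u \<in> V k \<and> v \<in> V (Suc k) \<and> \<not> E u v}) /
      (real (card (V k)) * real (card (V (Suc k))))) \<le> e"
  shows "spread E U ((\<Sum>k<m. real (card (V k)) / real (card U) * (\<psi> k - ln (real (card (V k)) / real (card U))))
     - ln 3 - 4 * e * ln B)"
proof -
  have "\<forall>k. \<exists>Qp. k < m \<longrightarrow> path_system E (V k) (fst Qp) (snd Qp) \<and> spreads E (fst Qp) (snd Qp) (\<psi> k)"
    using sp by (simp add: spread_def)
  from choice[OF this] obtain Qp where
    Qp: "\<And>k. k < m \<Longrightarrow> path_system E (V k) (fst (Qp k)) (snd (Qp k))"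
        "\<And>k. k < m \<Longrightarrow> spreads E (fst (Qp k)) (snd (Qp k)) (\<psi> k)" by blast
  interpret path_mixture E m V "\<lambda>k. fst (Qp k)" "\<lambda>k. snd (Qp k)"
    by standard (use assms Qp in auto)
  have UU: "path_mixture.U m V = U" by (simp add: U U_def)
  have "(\<Sum>k<m - 1. gap k) \<le> e"
    by (rule order_trans[OF sum_mono e]) (rule gap_le, auto)
  moreover have "- ln (lam k) \<le> ln B" if k: "k < m" for k
  proof -
    have c: "0 < real (card (V k))" "0 < real (card U)" using card_V_pos[OF k] card_U_pos UU by auto
    then have "0 < B" using B[OF k] by (meson less_le_trans zero_less_mult_pos2)
    have "- ln (lam k) = ln (real (card U) / real (card (V k)))" using c by (simp add: lam_def UU ln_div)
    also have "\<dots> \<le> ln B" using B[OF k] c by (intro ln_mono) (auto simp: field_simps)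
    finally show ?thesis .
  qed
  ultimately show ?thesis using spread_ordered[OF Qp(2), of "ln B" e] unfolding UU lam_def by simp
qed

section \<open>Depth-first search and pieces without backward edges\<close>

text \<open>\<open>F k\<close> is the set of finished vertices of a depth-first search and \<open>S k\<close> its stack, which is always a path.\<close>

lemma dfs_chain:
  assumes fin: "finite W" and short: "\<And>xs. dpath E xs \<Longrightarrow> set xs \<subseteq> W \<Longrightarrow> length xs \<le> l"
  obtains F S where "\<And>k. k \<le> card W \<Longrightarrow> F k \<subseteq> W \<and> card (F k) = k \<and> finite (S k) \<and> card (S k) \<le> l \<and>
      (\<forall>u\<in>F k. \<forall>v\<in>W - F k - S k. \<not> E u v)" "\<And>j k. j \<le> k \<Longrightarrow> k \<le> card W \<Longrightarrow> F j \<subseteq> F k"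
proof -
  define st where "st F xs \<longleftrightarrow> F \<subseteq> W \<and> dpath E xs \<and> set xs \<subseteq> W \<and> set xs \<inter> F = {} \<and>
    (\<forall>u\<in>F. \<forall>v\<in>W - F - set xs. \<not> E u v)" for F xs
  \<comment> \<open>Induction on the number of unvisited vertices. An unvisited out-neighbour of the
    top (or any unvisited vertex, if the stack is empty) is pushed; if there is none, the top has no
    edge to an unvisited vertex and becomes finished.\<close>
  have step: "\<exists>F' xs'. st F' xs' \<and> F \<subseteq> F' \<and> card F' = Suc (card F)" if "st F xs" "F \<noteq> W" for F xs
    using that
  proof (induction "card (W - F - set xs)" arbitrary: xs rule: less_induct)
    case less
    have F: "finite F" using less.prems fin finite_subset by (auto simp: st_def)
    show ?case
    proof (cases "\<exists>w\<in>W - F - set xs. xs = [] \<or> E (last xs) w")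
      case True
      then obtain w where w: "w \<in> W - F - set xs" "xs = [] \<or> E (last xs) w" by blast
      have "st F (xs @ [w])" using less.prems w by (auto simp: st_def dpath_def successively_append_iff)
      moreover have "card (W - F - set (xs @ [w])) < card (W - F - set xs)"
        using fin w by (intro psubset_card_mono) auto
      ultimately show ?thesis using less.hyps less.prems by blast
    next
      case False
      have xs: "xs \<noteq> []"
      proof
        assume "xs = []"
        moreover obtain w where "w \<in> W - F" using less.prems by (auto simp: st_def)
        ultimately show False using False by auto
      qed
      define x where "x = last xs"
      have eq: "xs = butlast xs @ [x]" using xs by (simp add: x_def)
      have s: "set xs = insert x (set (butlast xs))" by (subst eq) auto
      have "distinct xs" using less.prems by (simp add: st_def dpath_def)
      then have "distinct (butlast xs @ [x])" by (subst (asm) eq)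
      then have xb: "x \<notin> set (butlast xs)" by simp
      have d: "dpath E (butlast xs)" using less.prems dpath_take[of E xs] by (simp add: st_def butlast_conv_take)
      have "st (insert x F) (butlast xs)"
        unfolding st_def
      proof (intro conjI)
        show "set (butlast xs) \<inter> insert x F = {}"
        proof -
          have "set xs \<inter> F = {}" using less.prems by (simp add: st_def)
          then show ?thesis using s xb by auto
        qed
        show "\<forall>u\<in>insert x F. \<forall>v\<in>W - insert x F - set (butlast xs). \<not> E u v"
          using less.prems False s xs by (auto simp: st_def x_def)
      qed (use less.prems d s in \<open>auto simp: st_def\<close>)
      moreover have "x \<notin> F" using less.prems s by (auto simp: st_def)
      ultimately show ?thesis using F by (intro exI[of _ "insert x F"] exI[of _ "butlast xs"]) auto
    qed
  qed
  have "\<exists>f. \<forall>k. (k \<le> card W \<longrightarrow> st (fst (f k)) (snd (f k)) \<and> card (fst (f k)) = k) \<and>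
     (Suc k \<le> card W \<longrightarrow> fst (f k) \<subseteq> fst (f (Suc k)))"
  proof (rule dependent_nat_choice)
    show "\<exists>x. 0 \<le> card W \<longrightarrow> st (fst x) (snd x) \<and> card (fst x) = 0"
      by (intro exI[of _ "({}, [])"]) (simp add: st_def dpath_def)
  next
    fix x :: "'a set \<times> 'a list" and k
    assume x: "k \<le> card W \<longrightarrow> st (fst x) (snd x) \<and> card (fst x) = k"
    show "\<exists>y. (Suc k \<le> card W \<longrightarrow> st (fst y) (snd y) \<and> card (fst y) = Suc k) \<and> (Suc k \<le> card W \<longrightarrow> fst x \<subseteq> fst y)"
    proof (cases "Suc k \<le> card W")
      case True
      then have "st (fst x) (snd x)" "fst x \<noteq> W" "card (fst x) = k" using x by auto
      from step[OF this(1,2)] this(3) show ?thesis by auto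
    qed auto
  qed
  then obtain f where f: "\<And>k. k \<le> card W \<Longrightarrow> st (fst (f k)) (snd (f k)) \<and> card (fst (f k)) = k"
    and mono: "\<And>k. Suc k \<le> card W \<Longrightarrow> fst (f k) \<subseteq> fst (f (Suc k))" by blast
  show ?thesis
  proof (rule that[of "\<lambda>k. fst (f k)" "\<lambda>k. set (snd (f k))"])
    fix k assume "k \<le> card W"
    then show "fst (f k) \<subseteq> W \<and> card (fst (f k)) = k \<and> finite (set (snd (f k))) \<and> card (set (snd (f k))) \<le> l \<and>
      (\<forall>u\<in>fst (f k). \<forall>v\<in>W - fst (f k) - set (snd (f k)). \<not> E u v)"
      using f[of k] short[of "snd (f k)"] by (auto simp: st_def dpath_def distinct_card)
  next
    fix j k :: nat assume "j \<le> k" "k \<le> card W"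
    then show "fst (f j) \<subseteq> fst (f k)"
    proof (induction k)
      case (Suc k)
      then show ?case using mono[of k] by (cases "j = Suc k") auto
    qed simp
  qed
qed

text \<open>Cut the finishing order into blocks of \<open>h\<close> vertices and delete the stacks
  at the \<open>m\<close> cuts, at most \<open>m * l\<close> vertices in all. Blocks are numbered
  against the finishing order: when \<open>V k\<close> has just been finished, the vertices of
  \<open>V j\<close> with \<open>j < k\<close> are neither finished nor on the stack, so no edge
  leads from \<open>V k\<close> to \<open>V j\<close>.\<close>

lemma ordered_pieces:
  assumes fin: "finite W" and short: "\<And>xs. dpath E xs \<Longrightarrow> set xs \<subseteq> W \<Longrightarrow> length xs \<le> l"
    and h: "m * h \<le> card W"
  obtains V :: "nat \<Rightarrow> 'a set" where
    "\<And>k. k < m \<Longrightarrow> V k \<subseteq> W \<and> card (V k) \<le> h \<and> h \<le> card (V k) + m * l"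
    "\<And>j k. k < m \<Longrightarrow> j < k \<Longrightarrow> V j \<inter> V k = {} \<and> (\<forall>u\<in>V j. \<forall>v\<in>V k. \<not> E v u)"
proof -
  obtain F S where F: "\<And>k. k \<le> card W \<Longrightarrow> F k \<subseteq> W \<and> card (F k) = k \<and> finite (S k) \<and> card (S k) \<le> l \<and>
      (\<forall>u\<in>F k. \<forall>v\<in>W - F k - S k. \<not> E u v)" and mono: "\<And>j k. j \<le> k \<Longrightarrow> k \<le> card W \<Longrightarrow> F j \<subseteq> F k"
    by (rule dfs_chain[where W = W and E = E and l = l, OF fin short]) (assumption | rule that)+
  have le: "r * h \<le> card W" if "r \<le> m" for r using h mult_le_mono1[OF that, of h] by linarith
  define J where "J = (\<Union>r\<in>{1..m}. S (r * h))"
  have J: "finite J" "card J \<le> m * l"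
  proof -
    have S: "finite (S (r * h))" "card (S (r * h)) \<le> l" if "r \<in> {1..m}" for r
      using F[OF le[of r]] that by simp_all
    show "finite J" unfolding J_def using S by blast
    have "card J \<le> (\<Sum>r\<in>{1..m}. card (S (r * h)))" unfolding J_def by (intro card_UN_le) auto
    also have "\<dots> \<le> (\<Sum>r\<in>{1..m}. l)" by (intro sum_mono S)
    finally show "card J \<le> m * l" by simp
  qed
  define V where "V k = F ((m - k) * h) - F ((m - Suc k) * h) - J" for k
  show ?thesis
  proof (rule that[of V])
    fix k assume k: "k < m"
    let ?A = "F ((m - k) * h)" and ?B = "F ((m - Suc k) * h)"
    have mk: "(m - k) * h = (m - Suc k) * h + h" 
    proof -
      have "m - k = Suc (m - Suc k)" using k by simp
      then show ?thesis by (metis mult_Suc add.commute)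
    qed
    have A: "?A \<subseteq> W" "card ?A = (m - k) * h" and B: "?B \<subseteq> W" "card ?B = (m - Suc k) * h"
      using F[OF le[of "m - k"]] F[OF le[of "m - Suc k"]] by simp_all
    have finAB: "finite ?A" "finite ?B" using A B fin finite_subset by blast+
    have "?B \<subseteq> ?A" using mk le[of "m - k"] by (intro mono) linarith+
    then have "card (?A - ?B) = card ?A - card ?B" by (rule card_Diff_subset[OF finAB(2)])
    then have c: "card (?A - ?B) = h" using A(2) B(2) mk by linarith
    have "card (V k) \<le> h" unfolding V_def using finAB(1) by (subst c[symmetric]) (intro card_mono; blast)
    moreover have "h \<le> card (V k) + m * l"
      using diff_card_le_card_Diff[OF J(1), of "?A - ?B"] J(2) unfolding c V_def by linarith
    ultimately show "V k \<subseteq> W \<and> card (V k) \<le> h \<and> h \<le> card (V k) + m * l" using A unfolding V_def by blast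
  next
    fix j k assume k: "k < m" "j < k"
    have "(m - k) * h \<le> (m - Suc j) * h" using k by (intro mult_le_mono1) auto
    then have sub: "F ((m - k) * h) \<subseteq> F ((m - Suc j) * h)" using le[of "m - Suc j"] by (intro mono) auto
    have S: "S ((m - k) * h) \<subseteq> J" unfolding J_def using k by (intro UN_upper) auto
    have "F ((m - j) * h) \<subseteq> W" using F[OF le[of "m - j"]] by simp
    then have W: "V j \<subseteq> W" by (auto simp: V_def)
    have no_edge: "\<not> E v u" if "v \<in> F ((m - k) * h)" "u \<in> W - F ((m - k) * h) - S ((m - k) * h)" for u v
      using F[OF le[of "m - k"]] that by simp
    have Vk: "V k \<subseteq> F ((m - k) * h)" and Vj: "V j \<inter> F ((m - Suc j) * h) = {}" "V j \<inter> J = {}"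
      by (auto simp: V_def)
    show "V j \<inter> V k = {} \<and> (\<forall>u\<in>V j. \<forall>v\<in>V k. \<not> E v u)"
    proof (intro conjI ballI)
      show "V j \<inter> V k = {}" using Vk Vj(1) sub by blast
    next
      fix u v assume u: "u \<in> V j" and v: "v \<in> V k"
      show "\<not> E v u"
      proof (rule no_edge)
        show "v \<in> F ((m - k) * h)" using v Vk by blast
        show "u \<in> W - F ((m - k) * h) - S ((m - k) * h)" using u W Vj sub S by blast
      qed
    qed
  qed
qed

text \<open>Take a largest family of disjoint paths with exactly \<open>l\<close> vertices. Either
  it covers half of \<open>V\<close> and serves as items, or the uncovered set \<open>W\<close> is
  large and contains no such path by maximality.\<close>

lemma spread_or_few_paths:
  assumes fin: "finite V" "V \<noteq> {}" and l: "0 < l"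
  shows "spread E V (ln (real (l + 2 - 2 * ((l + 2) div 3)))) \<or>
    (\<exists>W\<subseteq>V. card V \<le> 2 * card W \<and> (\<forall>xs. dpath E xs \<longrightarrow> set xs \<subseteq> W \<longrightarrow> length xs < l))"
proof -
  define ok where "ok Q \<longleftrightarrow> disjoint_paths E V Q \<and> (\<forall>x\<in>set Q. length x = l)" for Q
  have card_ok: "card (\<Union>(set ` set Q)) = length Q * l" and sub: "\<Union>(set ` set Q) \<subseteq> V" if "ok Q" for Q
  proof -
    have dp: "disjoint_paths E V Q" using that by (simp add: ok_def)
    have "card (\<Union>(set ` set Q)) = (\<Sum>x\<in>set Q. card (set x))"
      using disjoint_paths_distinct[OF dp] by (intro card_UN_disjoint) auto
    also have "\<dots> = (\<Sum>x\<in>set Q. l)"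
      using that by (intro sum.cong refl) (auto simp: ok_def disjoint_paths_def dpath_def distinct_card)
    finally show "card (\<Union>(set ` set Q)) = length Q * l"
      using disjoint_paths_distinct(1)[OF dp] by (simp add: distinct_card)
    show "\<Union>(set ` set Q) \<subseteq> V" using dp by (auto simp: disjoint_paths_def)
  qed
  have bound: "length Q \<le> card V" if "ok Q" for Q
  proof -
    have "length Q * 1 \<le> length Q * l" using l by (intro mult_le_mono2) auto
    also have "\<dots> \<le> card V" using card_mono[OF fin(1) sub[OF that]] card_ok[OF that] by simp
    finally show ?thesis by simp
  qed
  have "ok []" by (simp add: ok_def disjoint_paths_def)
  then have "\<exists>Q. ok Q \<and> (\<forall>R. ok R \<longrightarrow> length R \<le> length Q)"
    by (rule ex_has_greatest_nat[where b = "Suc (card V)"]) (use bound in \<open>auto simp: less_Suc_eq_le\<close>)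
  then obtain Q where Q: "ok Q" and max: "\<And>R. ok R \<Longrightarrow> length R \<le> length Q" by auto
  define W where "W = V - \<Union>(set ` set Q)"
  have short: "length xs < l" if xs: "dpath E xs" "set xs \<subseteq> W" for xs
  proof (rule ccontr)
    assume "\<not> length xs < l"
    \<comment> \<open>A longer path is truncated, since all members of the family have exactly
      \<open>l\<close> vertices.\<close>
    define y where "y = take l xs"
    have y: "length y = l" "dpath E y" "set y \<subseteq> W" "y \<noteq> []"
      using xs \<open>\<not> length xs < l\<close> l dpath_take[of E xs l] by (auto simp: y_def dest: in_set_takeD)
    have "ok (Q @ [y])" using Q y unfolding ok_def disjoint_paths_append
      by (auto simp: disjoint_paths_def W_def)
    from max[OF this] show False by simp
  qed
  show ?thesis
  proof (cases "card V \<le> 2 * (length Q * l)")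
    case True
    have "spread E V (ln (real (l + 2 - 2 * ((l + 2) div 3))))"
      by (rule spread_disjoint_paths[OF fin _ _ True]) (use Q in \<open>simp_all add: ok_def\<close>)
    then show ?thesis ..
  next
    case False
    have "card W = card V - length Q * l" unfolding W_def using sub[OF Q] card_ok[OF Q] fin
      by (simp add: card_Diff_subset finite_subset)
    then have "card V \<le> 2 * card W" using False by linarith
    moreover have "W \<subseteq> V" by (auto simp: W_def)
    ultimately show ?thesis using short by blast
  qed
qed

section \<open>Coloured tournaments\<close>

lemma sum_card_disjoint_le:
  assumes "finite A" "finite I" "\<And>i. i \<in> I \<Longrightarrow> B i \<subseteq> A" "\<And>i j. i \<in> I \<Longrightarrow> j \<in> I \<Longrightarrow> i \<noteq> j \<Longrightarrow> B i \<inter> B j = {}"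
  shows "(\<Sum>i\<in>I. card (B i)) \<le> card A"
proof -
  have "(\<Sum>i\<in>I. card (B i)) = card (\<Union>i\<in>I. B i)"
    using assms finite_subset[OF assms(3) assms(1)] by (intro card_UN_disjoint[symmetric]) auto
  also have "\<dots> \<le> card A" using assms by (intro card_mono) auto
  finally show ?thesis .
qed

text \<open>The tangent to the convex function \<open>x * ln x\<close> at
  \<open>1/2\<close>.\<close>

lemma mult_ln_ge:
  fixes x :: real
  assumes "0 < x"
  shows "x * (1 - ln 2) - 1/2 \<le> x * ln x"
proof -
  have "ln (1 / (2 * x)) \<le> 1 / (2 * x) - 1" using assms by (intro ln_le_minus_one) simp
  then have "1 - ln 2 - 1 / (2 * x) \<le> ln x" using assms by (simp add: ln_div ln_mult_pos)
  then have "x * (1 - ln 2 - 1 / (2 * x)) \<le> x * ln x" using assms by (intro mult_left_mono) auto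
  then show ?thesis using assms by (simp add: algebra_simps)
qed

text \<open>Splitting a set in two costs at most the binary entropy, which is below 1. The bonus 4
  on a part containing at least a quarter of the set pays for it.\<close>

lemma split_gain:
  fixes x y n \<epsilon> C :: real
  assumes "0 < x" "0 < y" "n = x + y" "n \<le> 4 * x" "0 < \<epsilon>" "\<epsilon> < 1"
  shows "(1 - \<epsilon>) * ln n - C \<le> x / n * ((1 - \<epsilon>) * ln x - C + 4) + y / n * ((1 - \<epsilon>) * ln y - C)"
proof -
  define a b where "a = x / n" and "b = y / n"
  have n: "n > 0" using assms by simp
  have "a + b = (x + y) / n" by (simp add: a_def b_def add_divide_distrib)
  then have "a + b = 1" using assms n by simp
  moreover have "0 < a" "0 < b" "1/4 \<le> a" using assms(1,2,4) n by (auto simp: a_def b_def field_simps)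
  ultimately have ab: "0 < a" "0 < b" "1/4 \<le> a" "a + b = 1" by auto
  have lx: "ln x = ln n + ln a" and ly: "ln y = ln n + ln b" using assms n by (auto simp: a_def b_def ln_div)
  have "(0::real) < ln 2" by simp
  have ln2: "ln 2 \<le> (1::real)" using ln_le_minus_one[of 2] by simp
  have "a * (1 - ln 2) - 1/2 + (b * (1 - ln 2) - 1/2) \<le> a * ln a + b * ln b"
    by (intro add_mono mult_ln_ge ab)
  moreover have "a * (1 - ln 2) - 1/2 + (b * (1 - ln 2) - 1/2) = (a + b) * (1 - ln 2) - 1" by (simp add: algebra_simps)
  ultimately have "- 1 \<le> a * ln a + b * ln b" using ab ln2 by simp
  then have "(1 - \<epsilon>) * (- 1) \<le> (1 - \<epsilon>) * (a * ln a + b * ln b)" using assms by (intro mult_left_mono) auto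
  moreover have "0 \<le> 4 * a + (1 - \<epsilon>) * (- 1)" using ab(3) assms(5) by simp
  ultimately have *: "0 \<le> 4 * a + (1 - \<epsilon>) * (a * ln a + b * ln b)" by (meson add_left_mono order_trans)
  have b: "b = 1 - a" using ab by simp
  have "a * ((1 - \<epsilon>) * ln x - C + 4) + b * ((1 - \<epsilon>) * ln y - C) =
    (a + b) * ((1 - \<epsilon>) * ln n - C) + (4 * a + (1 - \<epsilon>) * (a * ln a + b * ln b))"
    unfolding lx ly by (simp add: algebra_simps)
  then show ?thesis using * ab unfolding a_def b_def by simp
qed

section \<open>The potential averaged over all colours\<close>

definition avoid :: "('a \<Rightarrow> 'a \<Rightarrow> bool) \<Rightarrow> ('a \<Rightarrow> 'a \<Rightarrow> nat) \<Rightarrow> nat \<Rightarrow> 'a \<Rightarrow> 'a \<Rightarrow> bool" where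
  "avoid T col i u v \<longleftrightarrow> T u v \<and> col u v \<noteq> i"

text \<open>Cutting into \<open>m\<close> pieces earns at least
  \<open>\<epsilon> * ln (m / 4)\<close> per colour. The required 7 splits into 2 for
  \<open>ln 3\<close>, 1 for missing links and 4 for \<open>split_gain\<close>. The bound on
  \<open>q\<close> keeps the losses from missing links, summed over all colours, below
  \<open>q\<close>.\<close>

locale colored_tournament =
  fixes T :: "'a \<Rightarrow> 'a \<Rightarrow> bool" and col :: "'a \<Rightarrow> 'a \<Rightarrow> nat" and q m :: nat and \<epsilon> :: real and carr :: "'a set"
  assumes m: "8 \<le> m" and eps: "0 < \<epsilon>" "\<epsilon> < 1" and gain: "7 \<le> \<epsilon> * ln (real m / 4)"
    and q: "4608 * (real m)\<^sup>2 * ln (4 * real m) \<le> \<epsilon> * real q"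
    and fin_carr: "finite carr"
    and total: "\<And>u v. u \<in> carr \<Longrightarrow> v \<in> carr \<Longrightarrow> u \<noteq> v \<Longrightarrow> T u v \<or> T v u"
begin

text \<open>Accounts for items with about \<open>n / (8 * m\<^sup>2)\<close> vertices, of which
  \<open>wt\<close> retains at least a third.\<close>

definition C :: real where "C = ln (24 * (real m)\<^sup>2)"

definition colored :: "'a set \<Rightarrow> nat \<Rightarrow> ('a \<times> 'a) set" where
  "colored V i = {(u, v). u \<in> V \<and> v \<in> V \<and> T u v \<and> col u v = i}"

text \<open>Only the sum over the colours is bounded, so individual colours may do badly at any
  stage of the induction.\<close>

definition good :: "'a set \<Rightarrow> (nat \<Rightarrow> real) \<Rightarrow> bool" where
  "good V \<psi> \<longleftrightarrow> (\<forall>i\<in>{1..q}. spread (avoid T col i) V (\<psi> i)) \<and>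
     real q * ((1 - \<epsilon>) * ln (real (card V)) - C) \<le> (\<Sum>i\<in>{1..q}. \<psi> i)"

lemma q_pos: "0 < q"
proof (rule Nat.gr0I)
  assume "q = 0"
  moreover have "0 < 4608 * (real m)\<^sup>2 * ln (4 * real m)" using m by simp
  ultimately show False using q by simp
qed

lemma C_nonneg: "0 \<le> C"
proof -
  have "1 \<le> (real m)\<^sup>2" using m by simp
  then have "1 \<le> 24 * (real m)\<^sup>2" by linarith
  then show ?thesis by (simp add: C_def)
qed

lemma finite_colored: "finite V \<Longrightarrow> finite (colored V i)"
  by (rule finite_subset[of _ "V \<times> V"]) (auto simp: colored_def)

lemma sum_colored: "finite V \<Longrightarrow> finite I \<Longrightarrow> (\<Sum>i\<in>I. card (colored V i)) \<le> card V * card V"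
  unfolding card_cartesian_product[symmetric]
  by (rule sum_card_disjoint_le) (auto simp: colored_def)

text \<open>Sparse colours have the long paths as items. Fewer colours than an \<epsilon>-fraction,
  or exactly that many, are dense; they get potential 0, and this loss is absorbed by the factor
  \<open>1 - \<epsilon>\<close>.\<close>

lemma good_of_long_paths:
  assumes fin: "finite V" "V \<noteq> {}" and l: "l = card V div (8 * m\<^sup>2) + 1"
    and D: "\<And>i. i \<in> {1..q} \<Longrightarrow> real (card (colored V i)) * (\<epsilon> * real q) \<le> (real (card V))\<^sup>2 \<Longrightarrow>
      spread (avoid T col i) V (ln (real (l + 2 - 2 * ((l + 2) div 3))))"
  shows "\<exists>\<psi>. good V \<psi>"
proof -
  define n where "n = card V"
  have n: "0 < n" using fin by (simp add: n_def card_gt_0_iff)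
  define w where "w = l + 2 - 2 * ((l + 2) div 3)"
  have w: "1 \<le> w" "l \<le> 3 * w" unfolding w_def using l by linarith+
  \<comment> \<open>The dense colours. Their classes are disjoint sets of ordered pairs of vertices,
    \<open>n\<^sup>2\<close> pairs in all, which bounds their number by
    \<open>\<epsilon> * q\<close>.\<close>
  define B where "B = {i\<in>{1..q}. (real n)\<^sup>2 < real (card (colored V i)) * (\<epsilon> * real q)}"
  have finB: "finite B" by (simp add: B_def)
  have "real (card B) * (real n)\<^sup>2 = (\<Sum>i\<in>B. (real n)\<^sup>2)" by simp
  also have "\<dots> \<le> (\<Sum>i\<in>B. real (card (colored V i)) * (\<epsilon> * real q))"
    by (intro sum_mono) (auto simp: B_def)
  also have "\<dots> = real (\<Sum>i\<in>B. card (colored V i)) * (\<epsilon> * real q)" by (simp add: sum_distrib_right)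
  also have "\<dots> \<le> real (n * n) * (\<epsilon> * real q)"
    using sum_colored[OF fin(1) finB] eps by (intro mult_right_mono of_nat_mono) (auto simp: n_def)
  finally have "real (card B) * (real n)\<^sup>2 \<le> (\<epsilon> * real q) * (real n)\<^sup>2" by (simp add: power2_eq_square mult_ac)
  then have cB: "real (card B) \<le> \<epsilon> * real q" using n by (simp add: mult_right_le_imp_le)
  define \<psi> where "\<psi> i = (if i \<in> B then 0 else ln (real w))" for i
  have "spread (avoid T col i) V (\<psi> i)" if "i \<in> {1..q}" for i
    using D[OF that] spread_singletons[OF fin] that by (auto simp: \<psi>_def B_def w_def n_def not_less)
  moreover have "real q * ((1 - \<epsilon>) * ln (real n) - C) \<le> (\<Sum>i\<in>{1..q}. \<psi> i)"
  proof -
    have "real n < real (8 * m\<^sup>2) * real l"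
    proof -
      have "n < 8 * m\<^sup>2 * l" unfolding l n_def[symmetric]
        using m dividend_less_times_div[of "8 * m\<^sup>2" n] by simp
      then show ?thesis by (metis of_nat_less_iff of_nat_mult)
    qed
    also have "\<dots> \<le> real (8 * m\<^sup>2) * real (3 * w)" using w by (intro mult_left_mono of_nat_mono) auto
    finally have "real n \<le> (24 * (real m)\<^sup>2) * real w" by simp
    then have "ln (real n) \<le> ln ((24 * (real m)\<^sup>2) * real w)" using n by (intro ln_mono) auto
    also have "\<dots> = C + ln (real w)" using m w by (simp add: C_def ln_mult_pos)
    finally have lnw: "ln (real n) - C \<le> ln (real w)" by simp
    have lnw0: "0 \<le> ln (real w)" using w by simp
    have "(1 - \<epsilon>) * ln (real n) - C \<le> (1 - \<epsilon>) * (ln (real n) - C)" using eps C_nonneg by (simp add: algebra_simps)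
    also have "\<dots> \<le> (1 - \<epsilon>) * ln (real w)" using eps lnw by (intro mult_left_mono) auto
    finally have "real q * ((1 - \<epsilon>) * ln (real n) - C) \<le> real q * ((1 - \<epsilon>) * ln (real w))"
      by (intro mult_left_mono) auto
    also have "\<dots> \<le> (real q - real (card B)) * ln (real w)"
    proof -
      have "real q * (1 - \<epsilon>) \<le> real q - real (card B)" using cB by (simp add: algebra_simps)
      from mult_right_mono[OF this lnw0] show ?thesis by (simp add: mult.assoc)
    qed
    also have "\<dots> = (\<Sum>i\<in>{1..q}. \<psi> i)"
    proof -
      have "(\<Sum>i\<in>{1..q}. \<psi> i) = (\<Sum>i\<in>{1..q} - B. ln (real w))"
        by (intro sum.mono_neutral_cong_right) (auto simp: \<psi>_def)
      moreover have "B \<subseteq> {1..q}" by (auto simp: B_def)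
      then have "card ({1..q} - B) = q - card B" "card B \<le> q"
        using finB card_mono[of "{1..q}" B] by (auto simp: card_Diff_subset)
      ultimately show ?thesis by (simp add: of_nat_diff)
    qed
    finally show ?thesis .
  qed
  ultimately show ?thesis unfolding good_def n_def by blast
qed

text \<open>The surplus 4 on \<open>X\<close> pays for joining \<open>X\<close> with the remaining
  vertices, by \<open>split_gain\<close> in the average over the colours.\<close>

lemma good_union:
  assumes fin: "finite X" "X \<noteq> {}" "finite Y" and disj: "X \<inter> Y = {}" and size: "card (X \<union> Y) \<le> 4 * card X"
    and X: "\<And>i. i \<in> {1..q} \<Longrightarrow> spread (avoid T col i) X (a i)"
      "real q * ((1 - \<epsilon>) * ln (real (card X)) - C + 4) \<le> (\<Sum>i\<in>{1..q}. a i)"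
    and Y: "Y \<noteq> {} \<Longrightarrow> good Y b"
  shows "\<exists>\<psi>. good (X \<union> Y) \<psi>"
proof (cases "Y = {}")
  case True
  have "real q * ((1 - \<epsilon>) * ln (real (card X)) - C) \<le> real q * ((1 - \<epsilon>) * ln (real (card X)) - C + 4)"
    by (intro mult_left_mono) auto
  then show ?thesis using True X by (auto simp: good_def intro!: exI[of _ a])
next
  case False
  define x y n where "x = real (card X)" and "y = real (card Y)" and "n = real (card (X \<union> Y))"
  have pos: "0 < x" "0 < y" using fin False by (auto simp: x_def y_def card_gt_0_iff)
  have n: "n = x + y" using card_Un_disjoint[OF fin(1,3) disj] by (simp add: x_def y_def n_def)
  have n4: "n \<le> 4 * x" using size unfolding n_def x_def by linarith
  have b: "good Y b" using Y False by simp
  define \<psi> where "\<psi> i = x / n * a i + y / n * b i" for i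
  have "spread (avoid T col i) (X \<union> Y) (\<psi> i)" if "i \<in> {1..q}" for i
    unfolding \<psi>_def x_def y_def n_def using b that X(1)
    by (intro spread_union fin False disj) (auto simp: good_def)
  moreover have "real q * ((1 - \<epsilon>) * ln n - C) \<le> (\<Sum>i\<in>{1..q}. \<psi> i)"
  proof -
    have "real q * ((1 - \<epsilon>) * ln n - C) \<le> real q * (x / n * ((1 - \<epsilon>) * ln x - C + 4) + y / n * ((1 - \<epsilon>) * ln y - C))"
      by (intro mult_left_mono split_gain pos n n4 eps) auto
    also have "\<dots> = x / n * (real q * ((1 - \<epsilon>) * ln x - C + 4)) + y / n * (real q * ((1 - \<epsilon>) * ln y - C))"
      by (simp add: algebra_simps)
    also have "\<dots> \<le> x / n * (\<Sum>i\<in>{1..q}. a i) + y / n * (\<Sum>i\<in>{1..q}. b i)"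
      using b X(2) pos n unfolding good_def x_def y_def by (intro add_mono mult_left_mono) auto
    also have "\<dots> = (\<Sum>i\<in>{1..q}. \<psi> i)" by (simp add: \<psi>_def sum.distrib sum_distrib_left)
    finally show ?thesis .
  qed
  ultimately show ?thesis unfolding good_def n_def by blast
qed

text \<open>A missing forward edge for colour \<open>i\<close> is either an edge of colour
  \<open>i\<close> or the reverse of an edge of the sparse colour \<open>i0\<close>. In the sum over
  \<open>i\<close> such pairs are rare, so the entropy gained by ordering the pieces survives for
  the average colour.\<close>

lemma ordered_gain:
  fixes P :: "nat \<Rightarrow> 'a set"
  assumes V: "V \<subseteq> carr" and n: "n = real (card V)" "0 < n"
    and i0: "real (card (colored V i0)) * (\<epsilon> * real q) \<le> n\<^sup>2"
    and P: "\<And>k. k < m \<Longrightarrow> P k \<subseteq> V \<and> real (card (P k)) \<le> n / real m \<and> n / (4 * real m) \<le> real (card (P k))"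
    and ord: "\<And>j k. k < m \<Longrightarrow> j < k \<Longrightarrow> P j \<inter> P k = {} \<and> (\<forall>u\<in>P j. \<forall>v\<in>P k. \<not> avoid T col i0 v u)"
    and good: "\<And>k. k < m \<Longrightarrow> good (P k) (\<psi> k)"
    and U: "U = (\<Union>k<m. P k)"
  shows "n \<le> 4 * real (card U)"
    and "\<exists>a. (\<forall>i\<in>{1..q}. spread (avoid T col i) U (a i)) \<and>
      real q * ((1 - \<epsilon>) * ln (real (card U)) - C + 4) \<le> (\<Sum>i\<in>{1..q}. a i)"
proof -
  have mpos: "0 < real m" "0 < m" using m by auto
  have finV: "finite V" using V fin_carr finite_subset by blast
  have finP: "finite (P k)" if "k < m" for k using P[OF that] finV finite_subset by blast
  have disj: "P j \<inter> P k = {}" if "j < m" "k < m" "j \<noteq> k" for j k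
    using ord[of j k] ord[of k j] that by (metis Int_commute linorder_neqE_nat)
  define c where "c k = real (card (P k))" for k
  have c: "c k \<le> n / real m" "n / (4 * real m) \<le> c k" if "k < m" for k using P[OF that] by (auto simp: c_def)
  have cpos: "0 < c k" if "k < m" for k
  proof -
    have "0 < n / (4 * real m)" using n mpos by simp
    then show ?thesis using c(2)[OF that] by linarith
  qed
  define cU where "cU = real (card U)"
  have "card U = (\<Sum>k<m. card (P k))" unfolding U using finP disj by (intro card_UN_disjoint) auto
  then have cU: "cU = (\<Sum>k<m. c k)" by (simp add: cU_def c_def)
  have "(\<Sum>k<m. n / (4 * real m)) \<le> cU" unfolding cU using c by (intro sum_mono) auto
  then have n_le: "n \<le> 4 * cU" using mpos by simp
  then show "n \<le> 4 * real (card U)" by (simp add: cU_def)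
  have cUpos: "0 < cU" using n n_le by linarith
  have "U \<subseteq> V" unfolding U using P by blast
  then have cUn: "cU \<le> n" unfolding cU_def n(1) using finV by (intro of_nat_mono card_mono)
  define bad where "bad i k = {(u, v). u \<in> P k \<and> v \<in> P (Suc k) \<and> \<not> avoid T col i u v}" for i k
  define e where "e i = (\<Sum>k<m - 1. 36 * real (card (bad i k)) / (c k * c (Suc k)))" for i
  define \<mu> where "\<mu> k = c k / cU" for k
  have mu_pos: "0 < \<mu> k" if "k < m" for k using cpos[OF that] cUpos by (simp add: \<mu>_def)
  have mu_sum: "(\<Sum>k<m. \<mu> k) = 1" using cUpos by (simp add: \<mu>_def cU flip: sum_divide_distrib)
  define a where "a i = (\<Sum>k<m. \<mu> k * (\<psi> k i - ln (\<mu> k))) - ln 3 - 4 * e i * ln (4 * real m)" for i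
  have spr: "spread (avoid T col i) U (a i)" if i: "i \<in> {1..q}" for i
    unfolding a_def \<mu>_def c_def cU_def
  proof (rule spread_ordered_pieces)
    show "0 < m" using mpos by simp
    show "U = (\<Union>k<m. P k)" by (rule U)
    show "(\<Sum>k<m - 1. 36 * real (card {(u, v). u \<in> P k \<and> v \<in> P (Suc k) \<and> \<not> avoid T col i u v}) /
      (real (card (P k)) * real (card (P (Suc k))))) \<le> e i"
      by (simp add: e_def bad_def c_def)
  next
    fix k assume k: "k < m"
    show "finite (P k)" "P k \<noteq> {}" using finP[OF k] cpos[OF k] by (auto simp: c_def)
    show "spread (avoid T col i) (P k) (\<psi> k i)" using good[OF k] i by (simp add: good_def)
    have "n \<le> 4 * real m * c k" using c(2)[OF k] mpos by (simp add: field_simps)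
    then show "real (card U) \<le> 4 * real m * real (card (P k))" using cUn by (simp add: c_def cU_def)
  qed (rule disj)
  have sum_bad: "(\<Sum>k<m - 1. card (bad i k)) \<le> card (colored V i0) + card (colored V i)" for i
  proof -
    have "(\<Sum>k<m - 1. card (bad i k)) \<le> card (prod.swap ` colored V i0 \<union> colored V i)"
    proof (rule sum_card_disjoint_le)
      show "finite (prod.swap ` colored V i0 \<union> colored V i)" using finite_colored[OF finV] by simp
    next
      fix k assume "k \<in> {..<m - 1}"
      then have k: "Suc k < m" by auto
      show "bad i k \<subseteq> prod.swap ` colored V i0 \<union> colored V i"
      proof (rule subrelI)
        fix u v assume "(u, v) \<in> bad i k"
        then have uv: "u \<in> P k" "v \<in> P (Suc k)" "\<not> avoid T col i u v" by (auto simp: bad_def)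
        then have V': "u \<in> V" "v \<in> V" using P[of k] P[of "Suc k"] k by auto
        have neq: "u \<noteq> v" using uv ord[OF k, of k] by auto
        have na: "\<not> avoid T col i0 v u" using uv ord[OF k, of k] by auto
        show "(u, v) \<in> prod.swap ` colored V i0 \<union> colored V i"
        proof (cases "T u v")
          case True
          then show ?thesis using uv V' by (auto simp: colored_def avoid_def)
        next
          case False
          then have "T v u" using total[of u v] neq V' V by blast
          then have "(v, u) \<in> colored V i0" using na V' by (auto simp: colored_def avoid_def)
          then show ?thesis by (force intro: image_eqI[of _ _ "(v, u)"])
        qed
      qed
    next
      fix j k assume jk: "j \<in> {..<m - 1}" "k \<in> {..<m - 1}" "j \<noteq> k"
      then have "P j \<inter> P k = {}" by (intro disj) auto
      then show "bad i j \<inter> bad i k = {}" by (auto simp: bad_def)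
    qed simp
    also have "\<dots> \<le> card (prod.swap ` colored V i0) + card (colored V i)" by (rule card_Un_le)
    also have "card (prod.swap ` colored V i0) = card (colored V i0)" by (simp add: card_image)
    finally show ?thesis .
  qed
  \<comment> \<open>Over all colours the missing pairs number at most \<open>q * card (colored V i0)
    + n\<^sup>2 \<le> 2 * n\<^sup>2 / \<epsilon>\<close>. The factor \<open>576 = 36 * 16\<close>
    comes from pieces of size at least \<open>n / (4 * m)\<close>.\<close>
  have e_sum: "(\<Sum>i\<in>{1..q}. 4 * e i * ln (4 * real m)) \<le> real q"
  proof -
    have "e i \<le> 576 * (real m)\<^sup>2 / n\<^sup>2 * (real (card (colored V i0)) + real (card (colored V i)))" for i
    proof -
      have "e i \<le> (\<Sum>k<m - 1. 576 * (real m)\<^sup>2 / n\<^sup>2 * real (card (bad i k)))"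
        unfolding e_def
      proof (rule sum_mono)
        fix k assume "k \<in> {..<m - 1}"
        then have k: "k < m" "Suc k < m" by auto
        have "(n / (4 * real m)) * (n / (4 * real m)) \<le> c k * c (Suc k)"
          using c(2) k n mpos cpos by (intro mult_mono) (auto simp: less_imp_le)
        then have "36 * real (card (bad i k)) / (c k * c (Suc k)) \<le> 36 * real (card (bad i k)) / ((n / (4 * real m)) * (n / (4 * real m)))"
          by (intro divide_left_mono mult_pos_pos cpos k) (use n mpos in auto)
        also have "\<dots> = 576 * (real m)\<^sup>2 / n\<^sup>2 * real (card (bad i k))"
          using n mpos by (simp add: power2_eq_square field_simps)
        finally show "36 * real (card (bad i k)) / (c k * c (Suc k)) \<le> 576 * (real m)\<^sup>2 / n\<^sup>2 * real (card (bad i k))" .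
      qed
      also have "\<dots> = 576 * (real m)\<^sup>2 / n\<^sup>2 * real (\<Sum>k<m - 1. card (bad i k))" by (simp add: sum_distrib_left)
      also have "\<dots> \<le> 576 * (real m)\<^sup>2 / n\<^sup>2 * real (card (colored V i0) + card (colored V i))"
        using sum_bad by (intro mult_left_mono of_nat_mono) auto
      finally show ?thesis by simp
    qed
    then have "(\<Sum>i\<in>{1..q}. e i) \<le> (\<Sum>i\<in>{1..q}. 576 * (real m)\<^sup>2 / n\<^sup>2 * (real (card (colored V i0)) + real (card (colored V i))))"
      by (intro sum_mono)
    also have "\<dots> = 576 * (real m)\<^sup>2 / n\<^sup>2 * (real q * real (card (colored V i0)) + real (\<Sum>i\<in>{1..q}. card (colored V i)))"
      unfolding sum_distrib_left[symmetric] sum.distrib by simp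
    also have "\<dots> \<le> 576 * (real m)\<^sup>2 / n\<^sup>2 * (2 * n\<^sup>2 / \<epsilon>)"
    proof (intro mult_left_mono)
      have "real q * real (card (colored V i0)) \<le> n\<^sup>2 / \<epsilon>" using i0 eps by (simp add: field_simps)
      moreover have "real (\<Sum>i\<in>{1..q}. card (colored V i)) \<le> n\<^sup>2"
        using of_nat_mono[OF sum_colored[OF finV, of "{1..q}"], where 'a = real] by (simp add: n power2_eq_square)
      moreover have "n\<^sup>2 \<le> n\<^sup>2 / \<epsilon>" using eps mult_left_le_one_le[of "n\<^sup>2" \<epsilon>] by (simp add: field_simps)
      ultimately show "real q * real (card (colored V i0)) + real (\<Sum>i\<in>{1..q}. card (colored V i)) \<le> 2 * n\<^sup>2 / \<epsilon>"
        by (simp add: field_simps)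
    qed auto
    also have "\<dots> = 1152 * (real m)\<^sup>2 / \<epsilon>" using n by simp
    finally have es: "(\<Sum>i\<in>{1..q}. e i) \<le> 1152 * (real m)\<^sup>2 / \<epsilon>" .
    have lnpos: "0 \<le> ln (4 * real m)" using m by simp
    have "(\<Sum>i\<in>{1..q}. 4 * e i * ln (4 * real m)) = 4 * ln (4 * real m) * (\<Sum>i\<in>{1..q}. e i)"
      unfolding sum_distrib_left by (intro sum.cong) (simp_all add: mult_ac)
    also have "\<dots> \<le> 4 * ln (4 * real m) * (1152 * (real m)\<^sup>2 / \<epsilon>)" using es lnpos by (intro mult_left_mono) auto
    also have "\<dots> \<le> real q" using q eps by (simp add: field_simps)
    finally show ?thesis .
  qed
  have "real q * ((1 - \<epsilon>) * ln cU - C + 4) \<le> (\<Sum>i\<in>{1..q}. a i)"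
  proof -
    have ln_mu: "ln (real m / 4) \<le> - ln (\<mu> k)" if k: "k < m" for k
    proof -
      have "\<mu> k \<le> (n / real m) / (n / 4)" unfolding \<mu>_def using c(1)[OF k] n_le n cUpos mpos cpos[OF k]
        by (intro frac_le) auto
      also have "\<dots> = 4 / real m" using n by simp
      finally have "ln (\<mu> k) \<le> ln (4 / real m)" using mu_pos[OF k] by (intro ln_mono) auto
      then show ?thesis using mpos by (simp add: ln_div)
    qed
    have "real q * ((1 - \<epsilon>) * ln cU - C + 7) = (\<Sum>k<m. \<mu> k) * (real q * ((1 - \<epsilon>) * ln cU - C + 7))"
      by (simp add: mu_sum)
    also have "\<dots> = (\<Sum>k<m. \<mu> k * (real q * ((1 - \<epsilon>) * ln cU - C + 7)))" by (rule sum_distrib_right)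
    also have "\<dots> \<le> (\<Sum>k<m. \<mu> k * (\<Sum>i\<in>{1..q}. \<psi> k i - ln (\<mu> k)))"
    proof (intro sum_mono mult_left_mono)
      fix k assume "k \<in> {..<m}" then have k: "k < m" by simp
      have ck: "ln (c k) = ln cU + ln (\<mu> k)" using cpos[OF k] cUpos by (simp add: \<mu>_def ln_div)
      \<comment> \<open>Passing from \<open>U\<close> to piece \<open>k\<close> lowers the target by
        \<open>(1 - \<epsilon>) * - ln (\<mu> k)\<close>, while the entropy returns
        \<open>- ln (\<mu> k)\<close>; the difference is the gain.\<close>
      have "7 \<le> \<epsilon> * - ln (\<mu> k)"
        using mult_left_mono[OF ln_mu[OF k], of \<epsilon>] eps gain by linarith
      then have "(1 - \<epsilon>) * ln cU - C + 7 \<le> (1 - \<epsilon>) * ln (c k) - C - ln (\<mu> k)" unfolding ck by (simp add: algebra_simps)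
      then have "real q * ((1 - \<epsilon>) * ln cU - C + 7) \<le> real q * ((1 - \<epsilon>) * ln (c k) - C - ln (\<mu> k))" by (intro mult_left_mono) auto
      also have "\<dots> = real q * ((1 - \<epsilon>) * ln (c k) - C) - real q * ln (\<mu> k)" by (simp add: algebra_simps)
      also have "\<dots> \<le> (\<Sum>i\<in>{1..q}. \<psi> k i) - real q * ln (\<mu> k)" using good[OF k] by (simp add: good_def c_def)
      also have "\<dots> = (\<Sum>i\<in>{1..q}. \<psi> k i - ln (\<mu> k))" by (simp add: sum_subtractf)
      finally show "real q * ((1 - \<epsilon>) * ln cU - C + 7) \<le> (\<Sum>i\<in>{1..q}. \<psi> k i - ln (\<mu> k))" .
    qed (use mu_pos in \<open>auto simp: less_imp_le\<close>)
    also have "\<dots> = (\<Sum>i\<in>{1..q}. \<Sum>k<m. \<mu> k * (\<psi> k i - ln (\<mu> k)))"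
      unfolding sum_distrib_left by (rule sum.swap)
    finally have main: "real q * ((1 - \<epsilon>) * ln cU - C + 7) \<le> (\<Sum>i\<in>{1..q}. \<Sum>k<m. \<mu> k * (\<psi> k i - ln (\<mu> k)))" .
    have "ln 3 \<le> (2::real)" using ln_le_minus_one[of 3] by simp
    then have "real q * ln 3 \<le> real q * 2" by (intro mult_left_mono) auto
    moreover have "(\<Sum>i\<in>{1..q}. a i) = (\<Sum>i\<in>{1..q}. \<Sum>k<m. \<mu> k * (\<psi> k i - ln (\<mu> k))) - real q * ln 3
        - (\<Sum>i\<in>{1..q}. 4 * e i * ln (4 * real m))"
      by (simp add: a_def sum_subtractf)
    ultimately show ?thesis using main e_sum by (simp add: algebra_simps)
  qed
  then show "\<exists>a. (\<forall>i\<in>{1..q}. spread (avoid T col i) U (a i)) \<and>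
      real q * ((1 - \<epsilon>) * ln (real (card U)) - C + 4) \<le> (\<Sum>i\<in>{1..q}. a i)"
    using spr unfolding cU_def by blast
qed

text \<open>The pieces of \<open>W\<close> have \<open>card W div m\<close> vertices before the
  stacks are removed. Writing \<open>n\<close> for \<open>card V\<close>, the total over
  \<open>m\<close> pieces of this size is at least \<open>n / 2\<close> up to rounding; rounding and
  the deleted stacks cost at most \<open>n / 8\<close> each, which leaves \<open>n / (4 * m)\<close>
  per piece.\<close>

lemma balanced_pieces:
  assumes fin: "finite V" "V \<noteq> {}" and W: "W \<subseteq> V" "card V \<le> 2 * card W"
    and short: "\<And>xs. dpath E xs \<Longrightarrow> set xs \<subseteq> W \<Longrightarrow> length xs \<le> card V div (8 * m\<^sup>2)"
  obtains P :: "nat \<Rightarrow> 'a set" where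
    "\<And>k. k < m \<Longrightarrow> P k \<subseteq> V \<and> real (card (P k)) \<le> real (card V) / real m \<and> real (card V) / (4 * real m) \<le> real (card (P k))"
    "\<And>j k. k < m \<Longrightarrow> j < k \<Longrightarrow> P j \<inter> P k = {} \<and> (\<forall>u\<in>P j. \<forall>v\<in>P k. \<not> E v u)"
proof -
  define l where "l = card V div (8 * m\<^sup>2)"
  define h where "h = card W div m"
  have finW: "finite W" using W fin finite_subset by blast
  have "0 < card V" using fin by (simp add: card_gt_0_iff)
  then have "W \<noteq> {}" using W by auto
  then obtain w where "w \<in> W" by blast
  \<comment> \<open>A single vertex of \<open>W\<close> is already a path, so the length bound is
    positive; this excludes small \<open>V\<close>, where rounding would matter.\<close>
  then have "1 \<le> l" using short[of "[w]"] by (simp add: dpath_def l_def)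
  then have big: "8 * m\<^sup>2 \<le> card V" by (metis l_def div_less not_le not_one_le_zero)
  have l8: "l * (8 * m\<^sup>2) \<le> card V" unfolding l_def by simp
  have mh: "m * h \<le> card W" "card W < m * h + m"
    unfolding h_def using m dividend_less_times_div[of m "card W"] by (auto simp: algebra_simps)
  obtain P :: "nat \<Rightarrow> 'a set" where
    P: "\<And>k. k < m \<Longrightarrow> P k \<subseteq> W \<and> card (P k) \<le> h \<and> h \<le> card (P k) + m * l" and
    ord: "\<And>j k. k < m \<Longrightarrow> j < k \<Longrightarrow> P j \<inter> P k = {} \<and> (\<forall>u\<in>P j. \<forall>v\<in>P k. \<not> E v u)"
    by (rule ordered_pieces[where W = W and E = E and l = l, OF finW short[folded l_def] mh(1)]) (assumption | rule that)+
  define n M H where "n = real (card V)" and "M = real m" and "H = real h"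
  have M: "8 \<le> M" using m by (simp add: M_def)
  have nM: "8 * M\<^sup>2 \<le> n" using of_nat_mono[OF big, where 'a = real] by (simp add: n_def M_def)
  have lM: "real l * (8 * M\<^sup>2) \<le> n" using of_nat_mono[OF l8, where 'a = real] by (simp add: n_def M_def)
  have "card W \<le> card V" using W fin by (intro card_mono)
  then have "m * h \<le> card V" using mh by linarith
  then have MH: "M * H \<le> n" using of_nat_mono[of "m * h" "card V", where 'a = real] by (simp add: n_def M_def H_def)
  have "2 * card W \<le> 2 * (m * h + m)" using mh(2) by (intro mult_le_mono2) simp
  then have "card V \<le> 2 * (m * h + m)" using W(2) by (rule order_trans[rotated])
  then have MH2: "n \<le> 2 * (M * H + M)" using of_nat_mono[of "card V" "2 * (m * h + m)", where 'a = real] by (simp add: n_def M_def H_def)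
  show ?thesis
  proof (rule that[of P])
    fix k assume k: "k < m"
    have "real (card (P k)) \<le> H" using P[OF k] by (simp add: H_def)
    also have "H \<le> n / M" using MH M by (simp add: field_simps)
    finally have up: "real (card (P k)) \<le> n / M" .
    have "H \<le> real (card (P k)) + M * real l"
      using P[OF k] of_nat_mono[of h "card (P k) + m * l", where 'a = real] by (simp add: H_def M_def)
    then have "M * H \<le> M * (real (card (P k)) + M * real l)" using M by (intro mult_left_mono) auto
    then have "M * H \<le> M * real (card (P k)) + n / 8" using lM by (simp add: power2_eq_square algebra_simps)
    moreover have "M \<le> n / 8"
    proof -
      have "8 * M \<le> M * M" using M by (intro mult_right_mono) auto
      then show ?thesis using nM M unfolding power2_eq_square by linarith
    qed
    moreover have "n \<le> 2 * (M * H) + 2 * M" using MH2 by (simp add: distrib_left)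
    ultimately have "n \<le> 4 * (M * real (card (P k)))" by linarith
    then have "n / (4 * M) \<le> real (card (P k))" using M by (simp add: field_simps)
    then show "P k \<subseteq> V \<and> real (card (P k)) \<le> real (card V) / real m \<and> real (card V) / (4 * real m) \<le> real (card (P k))"
      using up P[OF k] W unfolding n_def M_def by blast
  qed (rule ord)
qed

text \<open>Strong induction on the size. Either all sparse colours have long disjoint paths, or one
  of them yields ordered pieces. The pieces are good by induction, their union has a surplus, and
  the leftover vertices, again good by induction, are joined to it.\<close>

lemma ex_good:
  assumes "V \<subseteq> carr" "V \<noteq> {}"
  shows "\<exists>\<psi>. good V \<psi>"
  using assms
proof (induction "card V" arbitrary: V rule: less_induct)
  case less
  have fin: "finite V" using less.prems fin_carr finite_subset by blast
  have IH: "\<exists>\<psi>. good X \<psi>" if "X \<subset> V" "X \<noteq> {}" for X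
    using less.hyps[of X] less.prems that psubset_card_mono[OF fin that(1)] by blast
  define n where "n = real (card V)"
  have n: "0 < n" using fin less.prems by (simp add: n_def card_gt_0_iff)
  define l where "l = card V div (8 * m\<^sup>2) + 1"
  let ?long = "\<lambda>i. spread (avoid T col i) V (ln (real (l + 2 - 2 * ((l + 2) div 3))))"
  show ?case
  proof (cases "\<forall>i\<in>{1..q}. real (card (colored V i)) * (\<epsilon> * real q) \<le> n\<^sup>2 \<longrightarrow> ?long i")
    case True
    show ?thesis by (rule good_of_long_paths[OF fin less.prems(2) l_def]) (use True in \<open>simp add: n_def\<close>)
  next
    case False
    then obtain i0 where i0: "real (card (colored V i0)) * (\<epsilon> * real q) \<le> n\<^sup>2" "\<not> ?long i0" by blast
    have "0 < l" by (simp add: l_def)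
    from spread_or_few_paths[OF fin less.prems(2) this, of "avoid T col i0"] i0(2)
    obtain W where W: "W \<subseteq> V" "card V \<le> 2 * card W"
      and W_short: "\<forall>xs. dpath (avoid T col i0) xs \<longrightarrow> set xs \<subseteq> W \<longrightarrow> length xs < l" by blast
    have short: "length xs \<le> card V div (8 * m\<^sup>2)" if "dpath (avoid T col i0) xs" "set xs \<subseteq> W" for xs
    proof -
      have "length xs < l" using W_short that by blast
      then show ?thesis by (simp add: l_def)
    qed
    obtain P :: "nat \<Rightarrow> 'a set" where
      P: "\<And>k. k < m \<Longrightarrow> P k \<subseteq> V \<and> real (card (P k)) \<le> n / real m \<and> n / (4 * real m) \<le> real (card (P k))" and
      ord: "\<And>j k. k < m \<Longrightarrow> j < k \<Longrightarrow> P j \<inter> P k = {} \<and> (\<forall>u\<in>P j. \<forall>v\<in>P k. \<not> avoid T col i0 v u)"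
      by (rule balanced_pieces[OF fin less.prems(2) W short, folded n_def]) (assumption | rule that)+
    have "\<exists>\<psi>. good (P k) \<psi>" if k: "k < m" for k
    proof (rule IH)
      have "n / real m < n" using n m by (simp add: field_simps)
      then have "real (card (P k)) < real (card V)" using P[OF k] by (simp add: n_def)
      then show "P k \<subset> V" using P[OF k] by auto
      have "0 < n / (4 * real m)" using n m by simp
      then show "P k \<noteq> {}" using P[OF k] by auto
    qed
    then have "\<forall>k. \<exists>\<psi>. k < m \<longrightarrow> good (P k) \<psi>" by blast
    from choice[OF this] obtain \<psi> where \<psi>: "\<And>k. k < m \<Longrightarrow> good (P k) (\<psi> k)" by blast
    define U where "U = (\<Union>k<m. P k)"
    note og = ordered_gain[OF less.prems(1) n_def n i0(1) P ord \<psi> U_def]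
    have nU: "n \<le> 4 * real (card U)" by (rule og(1))
    obtain a where a: "\<forall>i\<in>{1..q}. spread (avoid T col i) U (a i)"
      "real q * ((1 - \<epsilon>) * ln (real (card U)) - C + 4) \<le> (\<Sum>i\<in>{1..q}. a i)"
      using og(2) by blast
    have UV: "U \<subseteq> V" unfolding U_def using P by blast
    have Une: "U \<noteq> {}" using nU n by auto
    have "\<exists>b. V - U \<noteq> {} \<longrightarrow> good (V - U) b" using IH[of "V - U"] UV Une by blast
    then obtain b where b: "V - U \<noteq> {} \<Longrightarrow> good (V - U) b" by blast
    have eq: "U \<union> (V - U) = V" using UV by blast
    have "\<exists>\<psi>. good (U \<union> (V - U)) \<psi>"
    proof (rule good_union)
      show "finite U" "finite (V - U)" using fin UV finite_subset by blast+
      show "card (U \<union> (V - U)) \<le> 4 * card U" unfolding eq using nU unfolding n_def by linarith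
    qed (use a b Une in auto)
    then show ?thesis unfolding eq .
  qed
qed

text \<open>Some colour reaches the average potential, and its potential yields the path.\<close>

lemma ex_long_path:
  assumes "carr \<noteq> {}"
  obtains i xs where "i \<in> {1..q}" "dpath (avoid T col i) xs" "set xs \<subseteq> carr"
    "real (card carr) powr (1 - \<epsilon>) / (24 * (real m)\<^sup>2) \<le> real (length xs)"
proof -
  obtain \<psi> where \<psi>: "good carr \<psi>" using ex_good[OF order_refl assms] by blast
  let ?b = "(1 - \<epsilon>) * ln (real (card carr)) - C"
  have "\<exists>i\<in>{1..q}. ?b \<le> \<psi> i"
  proof (rule ccontr)
    assume "\<not> ?thesis"
    then have "\<psi> i < ?b" if "i \<in> {1..q}" for i using that by (meson not_le)
    then have "(\<Sum>i\<in>{1..q}. \<psi> i) < (\<Sum>i\<in>{1..q}. ?b)" using q_pos by (intro sum_strict_mono) auto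
    then show False using \<psi> by (simp add: good_def)
  qed
  then obtain i where i: "i \<in> {1..q}" "?b \<le> \<psi> i" by blast
  then have "spread (avoid T col i) carr (\<psi> i)" using \<psi> by (simp add: good_def)
  then obtain xs where xs: "dpath (avoid T col i) xs" "set xs \<subseteq> carr" "exp (\<psi> i) \<le> real (length xs)"
    by (rule spread_imp_long_path)
  have "0 < real (card carr)" using assms fin_carr by (simp add: card_gt_0_iff)
  then have "real (card carr) powr (1 - \<epsilon>) / (24 * (real m)\<^sup>2) = exp ?b"
    using m by (simp add: powr_def exp_diff C_def)
  also have "\<dots> \<le> exp (\<psi> i)" using i by simp
  finally show ?thesis using that i xs by (meson order_trans)
qed

end

section \<open>Choice of parameters and conclusion\<close>

text \<open>Take \<open>m\<close> as the integer part of the fourth root of \<open>q\<close> and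
  \<open>\<epsilon> = 7 / ln (m / 4)\<close>, which makes the gain exactly 7. Then
  \<open>m ^ 4 \<le> q\<close> leaves room for the loss term of order \<open>m\<^sup>2\<close> up to
  logarithms.\<close>

lemma color_parameters:
  fixes q :: nat
  assumes q: "10 ^ 16 \<le> q"
  obtains m :: nat and \<epsilon> :: real where "8 \<le> m" "0 < \<epsilon>" "\<epsilon> < 1" "7 \<le> \<epsilon> * ln (real m / 4)"
    "4608 * (real m)\<^sup>2 * ln (4 * real m) \<le> \<epsilon> * real q" "\<epsilon> \<le> 112 / sqrt (log 2 (real q))"
proof -
  define x where "x = sqrt (sqrt (real q))"
  have x4: "x ^ 4 = real q"
  proof -
    have "x ^ 4 = (x\<^sup>2)\<^sup>2" by simp
    then show ?thesis by (simp add: x_def)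
  qed
  have x: "10 ^ 4 \<le> x"
  proof -
    have "(10 ^ 4) ^ 4 \<le> x ^ 4" unfolding x4 using of_nat_mono[OF q, where 'a = real] by simp
    moreover have "0 \<le> x" by (simp add: x_def)
    ultimately show ?thesis by (rule power_le_imp_le_base[of _ 3, simplified])
  qed
  define m where "m = nat \<lfloor>x\<rfloor>"
  define M where "M = real m"
  have M: "M \<le> x" "x < M + 1" "10 ^ 4 \<le> M"
  proof -
    have "0 \<le> \<lfloor>x\<rfloor>" using x by simp
    then have Mx: "M = of_int \<lfloor>x\<rfloor>" by (simp add: M_def m_def)
    then show "M \<le> x" "x < M + 1" by (simp_all add: Mx)
    have "10 ^ 4 \<le> \<lfloor>x\<rfloor>" using x by (simp add: le_floor_iff)
    then have "real_of_int (10 ^ 4) \<le> real_of_int \<lfloor>x\<rfloor>" by (simp only: of_int_le_iff)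
    then show "10 ^ 4 \<le> M" by (simp add: Mx)
  qed
  define L where "L = ln (M / 4)"
  \<comment> \<open>This is where \<open>10 ^ 16\<close> comes from: \<open>m / 4\<close> is at
    least 2500, which exceeds \<open>3 ^ 7 = 2187\<close>, and this makes
    \<open>\<epsilon> < 1\<close>.\<close>
  have L7: "7 < L"
  proof -
    have "exp (7::real) = exp 1 ^ 7" by (simp flip: exp_of_nat_mult)
    also have "\<dots> \<le> 3 ^ 7" using exp_le by (intro power_mono) auto
    also have "\<dots> < M / 4" using M by simp
    finally have "exp 7 < M / 4" .
    then have "ln (exp 7) < ln (M / 4)" by (subst ln_less_cancel_iff) (use M in auto)
    then show ?thesis by (simp add: L_def)
  qed
  define \<epsilon> where "\<epsilon> = 7 / L"
  have eps: "0 < \<epsilon>" "\<epsilon> < 1" using L7 by (auto simp: \<epsilon>_def)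
  have ln_q: "ln (real q) \<le> 8 * L"
  proof -
    have "x ^ 4 \<le> (M + 1) ^ 4" using M x by (intro power_mono) auto
    moreover have "M + 1 \<le> (M / 4)\<^sup>2"
    proof -
      have "M * 10000 \<le> M * M" using M by (intro mult_left_mono) auto
      moreover have "(M / 4)\<^sup>2 = M * M / 16" by (simp add: power2_eq_square)
      moreover have "10000 \<le> M" using M(3) by simp
      ultimately show ?thesis by linarith
    qed
    then have "(M + 1) ^ 4 \<le> ((M / 4)\<^sup>2) ^ 4" using M by (intro power_mono) auto
    ultimately have "real q \<le> (M / 4) ^ 8" unfolding x4 by (simp flip: power_mult)
    moreover have "0 < real q" using q by simp
    ultimately have "ln (real q) \<le> ln ((M / 4) ^ 8)" by (intro ln_mono) auto
    also have "\<dots> = 8 * L" using M by (simp add: L_def ln_realpow)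
    finally show ?thesis .
  qed
  have size: "4608 * M\<^sup>2 * ln (4 * M) \<le> \<epsilon> * real q"
  proof -
    \<comment> \<open>A fourth root gives \<open>ln (4 * M) \<le> 4 * r\<close>, so the product of
      the two logarithms is at most a multiple of \<open>sqrt M\<close>.\<close>
    define r where "r = sqrt (sqrt (4 * M))"
    have r: "0 < r" "r ^ 4 = 4 * M" 
    proof -
      show "0 < r" using M by (simp add: r_def)
      have "r ^ 4 = (r\<^sup>2)\<^sup>2" by simp
      also have "r\<^sup>2 = sqrt (4 * M)" using M by (simp add: r_def)
      also have "(sqrt (4 * M))\<^sup>2 = 4 * M" using M by (intro real_sqrt_pow2) simp
      finally show "r ^ 4 = 4 * M" .
    qed
    have "ln (4 * M) = 4 * ln r" using r ln_realpow[of r 4] by simp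
    also have "\<dots> \<le> 4 * r" using ln_le_minus_one[OF r(1)] by simp
    finally have l1: "ln (4 * M) \<le> 4 * r" .
    have l0: "0 \<le> ln (4 * M)" using M by simp
    have "L \<le> ln (4 * M)" unfolding L_def using M by (intro ln_mono) auto
    then have "L * ln (4 * M) \<le> (4 * r) * (4 * r)" using l1 l0 L7 by (intro mult_mono) auto
    also have "\<dots> = 16 * r\<^sup>2" by (simp add: power2_eq_square)
    also have "r\<^sup>2 = sqrt (4 * M)" using M by (simp add: r_def)
    also have "16 * sqrt (4 * M) = 32 * sqrt M" by (simp add: real_sqrt_mult)
    finally have LL: "L * ln (4 * M) \<le> 32 * sqrt M" .
    have "sqrt (100\<^sup>2) \<le> sqrt M" using M by (intro real_sqrt_le_mono) simp
    then have s: "100 \<le> sqrt M" by simp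
    have "4608 * 32 * sqrt M \<le> 7 * (sqrt M * M) * sqrt M"
    proof (intro mult_right_mono)
      have "100 * 10 ^ 4 \<le> sqrt M * M" using s M by (intro mult_mono) auto
      then show "4608 * 32 \<le> 7 * (sqrt M * M)" by simp
    qed (use M in auto)
    also have "\<dots> = 7 * M\<^sup>2" using M by (simp add: power2_eq_square)
    finally have "4608 * (L * ln (4 * M)) \<le> 7 * M\<^sup>2" using LL by linarith
    then have "M\<^sup>2 * (4608 * (L * ln (4 * M))) \<le> M\<^sup>2 * (7 * M\<^sup>2)" by (intro mult_left_mono) auto
    also have "\<dots> = 7 * M ^ 4" by (simp add: power2_eq_square power4_eq_xxxx)
    also have "\<dots> \<le> 7 * x ^ 4" using M by (intro mult_left_mono power_mono) auto
    finally show ?thesis using L7 by (simp add: x4 \<epsilon>_def field_simps)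
  qed
  \<comment> \<open>From \<open>ln q \<le> 8 * L\<close> and \<open>ln 2 \<ge> 1/2\<close> the
    logarithm of \<open>q\<close> to base 2 is at most \<open>16 * L\<close>, and
    \<open>112 = 7 * 16\<close>. Replacing it by its square root is a further weakening.\<close>
  have bound: "\<epsilon> \<le> 112 / sqrt (log 2 (real q))"
  proof -
    define K where "K = log 2 (real q)"
    have "2 \<le> real q" using q of_nat_mono[OF q, where 'a = real] by simp
    then have K: "1 \<le> K" unfolding K_def by (simp add: le_log_iff)
    have "ln (1 / 2) \<le> 1 / 2 - (1::real)" by (rule ln_le_minus_one) simp
    then have ln2: "1 / 2 \<le> ln (2::real)" by (simp add: ln_div)
    have "sqrt K \<le> K" using K by (simp add: real_le_lsqrt sqrt_le_D real_sqrt_le_iff power2_eq_square)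
    then have "sqrt K * (1 / 2) \<le> K * ln 2" using ln2 K by (intro mult_mono) auto
    also have "\<dots> = ln (real q)" by (simp add: K_def log_def)
    also note ln_q
    finally have "sqrt K \<le> 16 * L" by simp
    then have "7 * sqrt K \<le> 112 * L" by simp
    then show ?thesis using L7 K unfolding \<epsilon>_def K_def[symmetric] by (simp add: field_simps)
  qed
  have gain: "7 \<le> \<epsilon> * ln (real m / 4)" using L7 by (simp add: \<epsilon>_def L_def M_def)
  have "8 \<le> m" using M by (simp add: M_def)
  from that[OF this eps gain _ bound] size show ?thesis by (simp add: M_def)
qed

theorem theorem1p6:
  "\<exists>C::real. C > 0 \<and> (\<exists>c::nat \<Rightarrow> real. (\<forall>q\<ge>4. c q > 0) \<and>
     (\<forall>q::nat. q \<ge> 4 \<longrightarrow> (\<forall>N::nat. N > 0 \<longrightarrow>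
        (\<forall>T col. tournament N T \<and> edge_coloring N T q col \<longrightarrow>
           (\<exists>p. directed_path N T p \<and> color_avoiding q col p \<and>
              real (length p) \<ge> c q * real N powr (1 - C / sqrt (log 2 (real q))))))))"
proof -
  let ?P = "\<lambda>q c. c > 0 \<and> (\<forall>N>0. \<forall>T col. tournament N T \<longrightarrow> (\<exists>p. directed_path N T p \<and> color_avoiding q col p \<and>
    c * real N powr (1 - 112 / sqrt (log 2 (real q))) \<le> real (length p)))"
  have "\<forall>q. \<exists>c. 4 \<le> q \<longrightarrow> ?P q c"
  proof
    fix q :: nat
    show "\<exists>c. 4 \<le> q \<longrightarrow> ?P q c"
    proof (cases "10 ^ 16 \<le> q")
      case True
      then obtain m :: nat and \<epsilon> :: real where par: "8 \<le> m" "0 < \<epsilon>" "\<epsilon> < 1" "7 \<le> \<epsilon> * ln (real m / 4)"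
        "4608 * (real m)\<^sup>2 * ln (4 * real m) \<le> \<epsilon> * real q" and eps_le: "\<epsilon> \<le> 112 / sqrt (log 2 (real q))"
        by (rule color_parameters)
      have "?P q (1 / (24 * (real m)\<^sup>2))"
      proof (intro conjI allI impI)
        show "0 < 1 / (24 * (real m)\<^sup>2)" using par(1) by simp
      next
        fix N :: nat and T and col :: "nat \<Rightarrow> nat \<Rightarrow> nat"
        assume N: "0 < N" and T: "tournament N T"
        have total: "T u v \<or> T v u" if "u \<in> {0..<N}" "v \<in> {0..<N}" "u \<noteq> v" for u v
          using T that unfolding tournament_def by (meson atLeastLessThan_iff)
        interpret colored_tournament T col q m \<epsilon> "{0..<N}"
          by standard (rule par finite_atLeastLessThan total | assumption)+
        obtain i p where p: "i \<in> {1..q}" "dpath (avoid T col i) p" "set p \<subseteq> {0..<N}"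
          "real (card {0..<N}) powr (1 - \<epsilon>) / (24 * (real m)\<^sup>2) \<le> real (length p)"
          by (rule ex_long_path) (use N in simp_all)
        have "directed_path N T p" "color_avoiding q col p"
          using p by (auto simp: directed_path_def color_avoiding_def dpath_def avoid_def successively_conv_nth)
        moreover have "1 / (24 * (real m)\<^sup>2) * real N powr (1 - 112 / sqrt (log 2 (real q))) \<le> real (length p)"
        proof -
          have "real N powr (1 - 112 / sqrt (log 2 (real q))) \<le> real N powr (1 - \<epsilon>)"
          proof (rule powr_mono)
            show "1 - 112 / sqrt (log 2 (real q)) \<le> 1 - \<epsilon>" using eps_le by linarith
          qed (use N in simp)
          then have "real N powr (1 - 112 / sqrt (log 2 (real q))) / (24 * (real m)\<^sup>2) \<le> real N powr (1 - \<epsilon>) / (24 * (real m)\<^sup>2)"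
            by (rule divide_right_mono) simp
          then show ?thesis using p(4) by simp
        qed
        ultimately show "\<exists>p. directed_path N T p \<and> color_avoiding q col p \<and>
          1 / (24 * (real m)\<^sup>2) * real N powr (1 - 112 / sqrt (log 2 (real q))) \<le> real (length p)" by blast
      qed
      then show ?thesis by blast
    next
      case False
      \<comment> \<open>For these \<open>q\<close> the base-2 logarithm is at most 54, so the
        exponent is not positive and a single vertex is long enough.\<close>
      have "?P q 1" if q: "4 \<le> q"
      proof (intro conjI allI impI)
        fix N :: nat and T and col :: "nat \<Rightarrow> nat \<Rightarrow> nat"
        assume N: "0 < N"
        define K where "K = log 2 (real q)"
        have "real q \<le> 2 powr 54"
        proof -
          have "q \<le> 2 ^ 54" using False by simp
          from of_nat_mono[OF this, where 'a = real] show ?thesis by (simp add: powr_realpow[symmetric])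
        qed
        then have K54: "K \<le> 54" using q by (simp add: K_def log_le_iff)
        have "0 < K" using q by (simp add: K_def)
        have "sqrt K \<le> sqrt (112\<^sup>2)" using K54 by (intro real_sqrt_le_mono) simp
        then have "sqrt K \<le> 112" by simp
        then have "1 - 112 / sqrt K \<le> 0" using \<open>0 < K\<close> by simp
        then have "real N powr (1 - 112 / sqrt K) \<le> real N powr 0" using N by (intro powr_mono) auto
        then show "\<exists>p. directed_path N T p \<and> color_avoiding q col p \<and>
          1 * real N powr (1 - 112 / sqrt (log 2 (real q))) \<le> real (length p)"
          using N q by (intro exI[of _ "[0]"]) (auto simp: directed_path_def color_avoiding_def K_def)
      qed simp
      then show ?thesis by blast
    qed
  qed
  from choice[OF this] obtain c where "\<forall>q. 4 \<le> q \<longrightarrow> ?P q (c q)" ..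
  then show ?thesis by (intro exI[of _ "112::real"] conjI exI[of _ c]) auto
qed

end
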